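(* If the compact, connected metric graph $\mathcal{G}$ has diameter $D$ and total length $L$, then the second eigenvalue (spectral gap) of the Laplacian on $\mathcal{G}$ with standard conditions at all vertices satisfies $$\lambda_2^{\mathrm{N}}(\mathcal{G}) < \frac{24L}{D^3}.$$
   Context: A compact metric graph $\mathcal{G}=(\mathsf{V},\mathsf{E})$ has finitely many edges, each edge $\mathsf{e}$ being identified with an interval $(0,\ell_{\mathsf{e}})$ of finite length $\ell_{\mathsf{e}}>0$; loops and multiple edges are allowed. The total length $L$ is the sum of all edge lengths, and $\operatorname{dist}$ denotes the path metric on $\mathcal{G}$. The Laplacian with standard vertex conditions acts as $-\frac{d^2}{dx^2}$ on functions that are in $H^2(0,\ell_{\mathsf{e}})$ on each edge, are continuous at every vertex, and whose normal derivatives sum to zero at every vertex. It is self-adjoint with discrete spectrum; on a connected graph its eigenvalues, counted with multiplicity, are $0=\lambda_1^{\mathrm{N}}<\lambda_2^{\mathrm{N}}\leq\dots$. The diameter of $\mathcal{G}$ is $D=\max_{x_1,x_2\in\mathcal{G}}\operatorname{dist}(x_1,x_2)$, where $x_1,x_2$ range over all points of the metric graph (not only vertices). *)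

theory Defs
  imports
    "HOL-Analysis.Analysis"
    "HOL-Library.Function_Algebras"
    "Graph_Theory.Digraph_Component"
begin

text \<open>
  A compact metric graph: a finite multigraph (loops and multiple arcs allowed) with an edge length
  for every arc. The arc \<open>e\<close> stands for the interval from \<open>0\<close> (glued to \<open>tail G e\<close>) to \<open>len e\<close>
  (glued to \<open>head G e\<close>); the direction of an arc only fixes this parametrization. The
  one-point graph without edges is excluded, as it has no second eigenvalue and diameter \<open>0\<close>.
\<close>

locale metric_graph = fin_digraph G
  for G :: "('v, 'e) pre_digraph" +
  fixes len :: "'e \<Rightarrow> real"
  assumes len_pos: "e \<in> arcs G \<Longrightarrow> 0 < len e"
    and arcs_nonempty: "arcs G \<noteq> {}"

definition total_length :: "('v, 'e) pre_digraph \<Rightarrow> ('e \<Rightarrow> real) \<Rightarrow> real" where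
  "total_length G len = (\<Sum>e\<in>arcs G. len e)"


subsection \<open>Points, path metric and diameter\<close>

datatype ('v, 'e) mg_point = Vertex 'v | Interior 'e real

definition points :: "('v, 'e) pre_digraph \<Rightarrow> ('e \<Rightarrow> real) \<Rightarrow> ('v, 'e) mg_point set" where
  "points G len = Vertex ` verts G \<union> {Interior e x | e x. e \<in> arcs G \<and> 0 < x \<and> x < len e}"

definition edge_point ::
    "('v, 'e) pre_digraph \<Rightarrow> ('e \<Rightarrow> real) \<Rightarrow> 'e \<Rightarrow> real \<Rightarrow> ('v, 'e) mg_point" where
  "edge_point G len e x =
     (if x = 0 then Vertex (tail G e) else if x = len e then Vertex (head G e) else Interior e x)"

text \<open>
  A path is a list of segments; the segment \<open>(e, s, t)\<close> runs inside the closed edge \<open>e\<close> from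
  the point with coordinate \<open>s\<close> to the point with coordinate \<open>t\<close>.
\<close>

fun is_path :: "('v, 'e) pre_digraph \<Rightarrow> ('e \<Rightarrow> real) \<Rightarrow>
    ('v, 'e) mg_point \<Rightarrow> ('e \<times> real \<times> real) list \<Rightarrow> ('v, 'e) mg_point \<Rightarrow> bool" where
  "is_path G len p [] q \<longleftrightarrow> p = q"
| "is_path G len p ((e, s, t) # w) q \<longleftrightarrow>
     e \<in> arcs G \<and> s \<in> {0..len e} \<and> t \<in> {0..len e} \<and>
     p = edge_point G len e s \<and> is_path G len (edge_point G len e t) w q"

definition path_length :: "('e \<times> real \<times> real) list \<Rightarrow> real" where
  "path_length w = (\<Sum>(e, s, t)\<leftarrow>w. \<bar>t - s\<bar>)"

definition mg_dist :: "('v, 'e) pre_digraph \<Rightarrow> ('e \<Rightarrow> real) \<Rightarrow>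
    ('v, 'e) mg_point \<Rightarrow> ('v, 'e) mg_point \<Rightarrow> real" where
  "mg_dist G len p q = Inf {path_length w | w. is_path G len p w q}"

definition mg_diameter :: "('v, 'e) pre_digraph \<Rightarrow> ('e \<Rightarrow> real) \<Rightarrow> real" where
  "mg_diameter G len = (SUP (p, q)\<in>points G len \<times> points G len. mg_dist G len p q)"


subsection \<open>The Laplacian with standard vertex conditions\<close>

text \<open>
  \<open>u \<in> H\<^sup>2(0,l)\<close> with derivatives \<open>u'\<close> and \<open>u''\<close>, for the representative of \<open>u\<close> that is continuous on
  \<open>[0,l]\<close>: \<open>u\<close> is continuously differentiable up to the boundary and \<open>u'\<close> is absolutely continuous
  with derivative \<open>u'' \<in> L\<^sup>2(0,l)\<close>.
\<close>

definition H2_interval ::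
    "real \<Rightarrow> (real \<Rightarrow> complex) \<Rightarrow> (real \<Rightarrow> complex) \<Rightarrow> (real \<Rightarrow> complex) \<Rightarrow> bool" where
  "H2_interval l u u' u'' \<longleftrightarrow>
     (\<forall>x\<in>{0..l}. (u has_vector_derivative u' x) (at x within {0..l})) \<and>
     set_borel_measurable lborel {0..l} u'' \<and>
     set_integrable lborel {0..l} (\<lambda>x. (cmod (u'' x))\<^sup>2) \<and>
     (\<forall>x\<in>{0..l}. u' x = u' 0 + (LINT t:{0..x}|lborel. u'' t))"

definition continuous_at_vertex ::
    "('v, 'e) pre_digraph \<Rightarrow> ('e \<Rightarrow> real) \<Rightarrow> ('e \<Rightarrow> real \<Rightarrow> complex) \<Rightarrow> 'v \<Rightarrow> bool" where
  "continuous_at_vertex G len f v \<longleftrightarrow>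
     (\<exists>c. (\<forall>e\<in>out_arcs G v. f e 0 = c) \<and> (\<forall>e\<in>in_arcs G v. f e (len e) = c))"

text \<open>The normal derivatives point from the vertex into the edges; a loop contributes twice.\<close>

definition kirchhoff_at_vertex ::
    "('v, 'e) pre_digraph \<Rightarrow> ('e \<Rightarrow> real) \<Rightarrow> ('e \<Rightarrow> real \<Rightarrow> complex) \<Rightarrow> 'v \<Rightarrow> bool" where
  "kirchhoff_at_vertex G len f' v \<longleftrightarrow>
     (\<Sum>e\<in>out_arcs G v. f' e 0) + (\<Sum>e\<in>in_arcs G v. - f' e (len e)) = 0"

text \<open>
  \<open>std_laplacian G len f g\<close>: \<open>f\<close> is in the domain of the Laplacian and \<open>g = -f''\<close> almost everywhere.
  An element of the domain, a class of functions on the disjoint union of the edges, is represented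
  by its continuous representative on the closed edges, extended by \<open>0\<close>. The extension makes
  representatives unique, so that dimensions can be computed in the function space.
\<close>

definition std_laplacian :: "('v, 'e) pre_digraph \<Rightarrow> ('e \<Rightarrow> real) \<Rightarrow>
    ('e \<Rightarrow> real \<Rightarrow> complex) \<Rightarrow> ('e \<Rightarrow> real \<Rightarrow> complex) \<Rightarrow> bool" where
  "std_laplacian G len f g \<longleftrightarrow>
     (\<forall>e x. \<not> (e \<in> arcs G \<and> x \<in> {0..len e}) \<longrightarrow> f e x = 0) \<and>
     (\<forall>v\<in>verts G. continuous_at_vertex G len f v) \<and>
     (\<exists>f' f''.
        (\<forall>e\<in>arcs G. H2_interval (len e) (f e) (f' e) (f'' e)) \<and>
        (\<forall>v\<in>verts G. kirchhoff_at_vertex G len f' v) \<and>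
        (\<forall>e\<in>arcs G. AE x\<in>{0..len e} in lborel. g e x = - f'' e x))"


subsection \<open>Eigenvalues, counted with multiplicity\<close>

global_interpretation edge_fun:
  vector_space "\<lambda>(c :: complex) (f :: 'e \<Rightarrow> real \<Rightarrow> complex) e x. c * f e x"
  by unfold_locales (auto simp: fun_eq_iff algebra_simps)

definition eigenspace ::
    "('v, 'e) pre_digraph \<Rightarrow> ('e \<Rightarrow> real) \<Rightarrow> real \<Rightarrow> ('e \<Rightarrow> real \<Rightarrow> complex) set" where
  "eigenspace G len \<mu> = {f. std_laplacian G len f (\<lambda>e x. complex_of_real \<mu> * f e x)}"

definition multiplicity :: "('v, 'e) pre_digraph \<Rightarrow> ('e \<Rightarrow> real) \<Rightarrow> real \<Rightarrow> nat" where
  "multiplicity G len \<mu> = edge_fun.dim (eigenspace G len \<mu>)"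

definition eigenvalues :: "('v, 'e) pre_digraph \<Rightarrow> ('e \<Rightarrow> real) \<Rightarrow> real set" where
  "eigenvalues G len = {\<mu>. \<exists>f\<in>eigenspace G len \<mu>. f \<noteq> 0}"

text \<open>
  The \<open>k\<close>-th eigenvalue (\<open>k \<ge> 1\<close>) of the nondecreasing enumeration with multiplicity: the least \<open>t\<close>
  such that at least \<open>k\<close> eigenvalues, counted with multiplicity, lie in \<open>(-\<infinity>, t]\<close>.
\<close>

definition kth_eigenvalue :: "('v, 'e) pre_digraph \<Rightarrow> ('e \<Rightarrow> real) \<Rightarrow> nat \<Rightarrow> real" where
  "kth_eigenvalue G len k =
     Inf {t. \<exists>S. finite S \<and> S \<subseteq> eigenvalues G len \<inter> {..t} \<and>
             k \<le> (\<Sum>\<mu>\<in>S. multiplicity G len \<mu>)}"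

end

theory Submission
  imports Defs "HOL-Probability.Sinc_Integral"
begin

text \<open>
  The idea is to test the Rayleigh quotient with the distance \<open>d\<close> from one end \<open>p\<close> of a (nearly)
  diametral pair of points. This function has slope at most \<open>1\<close>, so its energy is at most \<open>L\<close>. By
  connectedness it takes every value between \<open>0\<close> and \<open>D\<close>, and again because of the slope, its
  distribution dominates Lebesgue measure on \<open>[0,D]\<close>; hence \<open>\<integral>(d + c)\<^sup>2 \<ge> D\<^sup>3/12\<close> for every constant
  \<open>c\<close>. The Rayleigh quotient of \<open>d\<close> minus its mean is therefore at most \<open>12L/D\<^sup>3\<close>. As this is half of
  the claimed bound, there is room for approximation.

  The eigenvalue itself is found by a reduction to finite dimension. Cut every edge into \<open>N\<close> equal
  segments, so short that no Dirichlet eigenvalue of a segment is in the range of interest. A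
  function on the cut points and vertices (the nodes) then extends uniquely to a solution of
  \<open>-u'' = k\<^sup>2u\<close> on the segments. Its normal derivatives balance at all nodes, i.e. the extension is an
  eigenfunction for \<open>k\<^sup>2\<close>, iff the nodal function is in the kernel of a symmetric matrix depending
  continuously on \<open>k\<close> (\<open>eigenvalue_of_grid_function\<close>).

  That this kernel is nontrivial for some \<open>k \<in> (0,K]\<close> is a statement about weighted networks
  (\<open>kernel_exists\<close>). Write \<open>Q\<^sub>k\<close> for the quadratic form of the matrix; it is the integral of
  \<open>\<bar>u'\<bar>\<^sup>2 - k\<^sup>2\<bar>u\<bar>\<^sup>2\<close> over the extension. Among all \<open>k \<le> K\<close> for which some nonzero nodal function with
  extension of mean zero has \<open>Q\<^sub>k \<le> 0\<close>, there is a smallest one by compactness. It is positive, as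
  \<open>Q\<^sub>0\<close> vanishes on constants only, and there the minimizing function is in the kernel, for otherwise
  a gradient step would make the form negative and \<open>k\<close> could be decreased further.

  That \<open>k = K\<close> is admissible for \<open>K\<^sup>2 = 20L/D\<^sup>3\<close> is the discrete form of the test function
  argument above. In it, integrals over the values of \<open>d\<close> are avoided: the total variation of
  \<open>(d + c)\<^sup>3/3\<close> along the segments is at least the oscillation of this function
  (\<open>range_le_total_variation\<close>).

  To conclude, \<open>0\<close> and \<open>k\<^sup>2\<close> are two different eigenvalues. All eigenvalues are nonnegative and have
  positive, finite multiplicity, so \<open>k\<^sup>2\<close> bounds the second one from above (\<open>second_eigenvalue_le\<close>).
\<close>

section \<open>Finite connected networks\<close>

text \<open>
  A finite multigraph with segments \<open>s\<close> joining \<open>a s\<close> and \<open>b s\<close>. Connectedness is expressed without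
  walks: a property that is passed on along segments holds everywhere or nowhere.
\<close>

locale finite_network =
  fixes S :: "'s set" and a b :: "'s \<Rightarrow> 'x"
  assumes finite_S: "finite S" and S_nonempty: "S \<noteq> {}"
    and network_connected:
      "\<And>P x y. (\<And>s. s \<in> S \<Longrightarrow> P (a s) = P (b s)) \<Longrightarrow>
        x \<in> a ` S \<union> b ` S \<Longrightarrow> y \<in> a ` S \<union> b ` S \<Longrightarrow> P x \<Longrightarrow> P y"
begin

definition nodes :: "'x set" where "nodes = a ` S \<union> b ` S"

lemma finite_nodes: "finite nodes"
  unfolding nodes_def using finite_S by auto

lemma ends_in_nodes: "s \<in> S \<Longrightarrow> a s \<in> nodes" "s \<in> S \<Longrightarrow> b s \<in> nodes"
  by (auto simp: nodes_def)

lemma constant_on_nodes: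
  assumes "\<And>s. s \<in> S \<Longrightarrow> f (a s) = f (b s)" and "x \<in> nodes" "y \<in> nodes"
  shows "f x = f y"
  using network_connected[of "\<lambda>z. f x = f z" x y] assms by (auto simp: nodes_def)

text \<open>
  The intervals spanned by the values of \<open>f\<close> at the two ends of a segment cover \<open>[f x, f y]\<close>: at an
  uncovered level \<open>t\<close>, the property \<open>f \<le> t\<close> would be passed on along all segments, from \<open>x\<close> to \<open>y\<close>,
  so that \<open>t = f y\<close>, which is covered. In this way no simple path from \<open>x\<close> to \<open>y\<close> has to be chosen.
\<close>

lemma range_le_total_variation:
  fixes f :: "'x \<Rightarrow> real"
  assumes x: "x \<in> nodes" and y: "y \<in> nodes"
  shows "f y - f x \<le> (\<Sum>s\<in>S. \<bar>f (a s) - f (b s)\<bar>)"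
proof (cases "f x \<le> f y")
  case True
  define J where "J s = {min (f (a s)) (f (b s)) .. max (f (a s)) (f (b s))}" for s
  have cover: "{f x..f y} \<subseteq> (\<Union>s\<in>S. J s)"
  proof
    fix t assume t: "t \<in> {f x..f y}"
    show "t \<in> (\<Union>s\<in>S. J s)"
    proof (rule ccontr)
      assume no: "t \<notin> (\<Union>s\<in>S. J s)"
      have "(f (a s) \<le> t) = (f (b s) \<le> t)" if "s \<in> S" for s
        using no that by (fastforce simp: J_def min_def max_def split: if_splits)
      then have "f y \<le> t"
        using network_connected[of "\<lambda>z. f z \<le> t" x y] x y t by (auto simp: nodes_def)
      then have t_eq: "f y = t" using t by simp
      then show False using no y by (fastforce simp: J_def nodes_def)
    qed
  qed
  have "ennreal (f y - f x) = emeasure lborel {f x..f y}"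
    using True by simp
  also have "\<dots> \<le> emeasure lborel (\<Union>s\<in>S. J s)"
    using finite_S by (intro emeasure_mono cover) (auto simp: J_def intro!: sets.finite_UN)
  also have "\<dots> \<le> (\<Sum>s\<in>S. emeasure lborel (J s))"
    using finite_S by (intro emeasure_subadditive_finite) (auto simp: J_def)
  also have "\<dots> = (\<Sum>s\<in>S. ennreal \<bar>f (a s) - f (b s)\<bar>)"
    by (intro sum.cong refl) (auto simp: J_def min_def max_def)
  also have "\<dots> = ennreal (\<Sum>s\<in>S. \<bar>f (a s) - f (b s)\<bar>)"
    by simp
  finally show ?thesis
    by (subst (asm) ennreal_le_iff) (auto intro: sum_nonneg)
next
  case False
  have "0 \<le> (\<Sum>s\<in>S. \<bar>f (a s) - f (b s)\<bar>)" by (intro sum_nonneg) auto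
  then show ?thesis using False by linarith
qed

end

section \<open>Kernels of frequency-dependent forms on networks\<close>

text \<open>
  The weights belong to the equation \<open>-u'' = k\<^sup>2u\<close> on the segments: for the solution \<open>u\<close> with end
  values \<open>x\<close> and \<open>y\<close>, \<open>\<sigma>(x - y)\<^sup>2 - k\<^sup>2\<tau>(x\<^sup>2 + y\<^sup>2)\<close> is the integral of \<open>u'\<^sup>2 - k\<^sup>2u\<^sup>2\<close>, and
  \<open>\<tau>(x + y)\<close> is the integral of \<open>u\<close>. For the existence of a kernel they may be any positive
  continuous functions of \<open>k\<close>.
\<close>

locale weighted_network = finite_network S a b
  for S :: "'s set" and a b :: "'s \<Rightarrow> 'x" +
  fixes \<sigma> \<tau> :: "'s \<Rightarrow> real \<Rightarrow> real" and K :: real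
  assumes K_pos: "0 < K"
    and \<sigma>_cont: "s \<in> S \<Longrightarrow> continuous_on {0..K} (\<sigma> s)"
    and \<tau>_cont: "s \<in> S \<Longrightarrow> continuous_on {0..K} (\<tau> s)"
    and \<sigma>_pos: "s \<in> S \<Longrightarrow> k \<in> {0..K} \<Longrightarrow> 0 < \<sigma> s k"
    and \<tau>_pos: "s \<in> S \<Longrightarrow> k \<in> {0..K} \<Longrightarrow> 0 < \<tau> s k"
begin

definition form :: "real \<Rightarrow> ('x \<Rightarrow> real) \<Rightarrow> ('x \<Rightarrow> real) \<Rightarrow> real" where
  "form k \<phi> \<psi> = (\<Sum>s\<in>S. \<sigma> s k * (\<phi> (a s) - \<phi> (b s)) * (\<psi> (a s) - \<psi> (b s))
     - k\<^sup>2 * \<tau> s k * (\<phi> (a s) * \<psi> (a s) + \<phi> (b s) * \<psi> (b s)))"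

definition mass :: "real \<Rightarrow> ('x \<Rightarrow> real) \<Rightarrow> real" where
  "mass k \<phi> = (\<Sum>s\<in>S. \<tau> s k * (\<phi> (a s) + \<phi> (b s)))"

text \<open>
  The matrix of \<open>form k\<close>. In terms of the solutions on the segments, its value at a node is the
  negative sum of the normal derivatives.
\<close>

definition vertex_op :: "real \<Rightarrow> ('x \<Rightarrow> real) \<Rightarrow> 'x \<Rightarrow> real" where
  "vertex_op k \<phi> x =
     (\<Sum>s | s \<in> S \<and> a s = x. \<sigma> s k * (\<phi> (a s) - \<phi> (b s)) - k\<^sup>2 * \<tau> s k * \<phi> (a s)) +
     (\<Sum>s | s \<in> S \<and> b s = x. \<sigma> s k * (\<phi> (b s) - \<phi> (a s)) - k\<^sup>2 * \<tau> s k * \<phi> (b s))"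

lemma form_eq_vertex_op: "form k \<phi> \<psi> = (\<Sum>x\<in>nodes. vertex_op k \<phi> x * \<psi> x)"
proof -
  define A where "A s = \<sigma> s k * (\<phi> (a s) - \<phi> (b s)) - k\<^sup>2 * \<tau> s k * \<phi> (a s)" for s
  define B where "B s = \<sigma> s k * (\<phi> (b s) - \<phi> (a s)) - k\<^sup>2 * \<tau> s k * \<phi> (b s)" for s
  have "(\<Sum>x\<in>nodes. \<Sum>s | s \<in> S \<and> a s = x. A s * \<psi> (a s)) = (\<Sum>s\<in>S. A s * \<psi> (a s))"
    by (rule sum.group) (use finite_S finite_nodes ends_in_nodes in auto)
  moreover have "(\<Sum>x\<in>nodes. \<Sum>s | s \<in> S \<and> b s = x. B s * \<psi> (b s)) = (\<Sum>s\<in>S. B s * \<psi> (b s))"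
    by (rule sum.group) (use finite_S finite_nodes ends_in_nodes in auto)
  moreover have "vertex_op k \<phi> x * \<psi> x = (\<Sum>s | s \<in> S \<and> a s = x. A s * \<psi> (a s))
      + (\<Sum>s | s \<in> S \<and> b s = x. B s * \<psi> (b s))" for x
    unfolding vertex_op_def A_def[symmetric] B_def[symmetric] distrib_right sum_distrib_right
    by (intro arg_cong2[of _ _ _ _ "(+)"] sum.cong) auto
  moreover have "form k \<phi> \<psi> = (\<Sum>s\<in>S. A s * \<psi> (a s)) + (\<Sum>s\<in>S. B s * \<psi> (b s))"
    unfolding form_def sum.distrib[symmetric] A_def B_def
    by (intro sum.cong) (auto simp: algebra_simps)
  ultimately show ?thesis by (simp add: sum.distrib)
qed

lemma form_perturb:
  "form k (\<lambda>x. \<phi> x + e * z x) (\<lambda>x. \<phi> x + e * z x) = form k \<phi> \<phi> + 2 * e * form k \<phi> z + e\<^sup>2 * form k z z"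
  unfolding form_def sum_distrib_left sum.distrib[symmetric]
  by (intro sum.cong) (auto simp: algebra_simps power2_eq_square)

text \<open>
  This relation between \<open>form\<close> and \<open>mass\<close> is why both use the same weight \<open>\<tau>\<close>: on functions of mass
  zero, adding a constant to the second argument does not change the form.
\<close>

lemma form_const: "form k \<phi> (\<lambda>_. c) = - k\<^sup>2 * c * mass k \<phi>"
  unfolding form_def mass_def sum_distrib_left
  by (intro sum.cong) (auto simp: algebra_simps)

lemma form_diff: "form k \<phi> (\<lambda>x. \<psi> x - \<theta> x) = form k \<phi> \<psi> - form k \<phi> \<theta>"
  unfolding form_def sum_subtractf[symmetric]
  by (intro sum.cong) (auto simp: algebra_simps)

lemma form_scale: "form k (\<lambda>x. c * \<phi> x) (\<lambda>x. c * \<phi> x) = c\<^sup>2 * form k \<phi> \<phi>"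
  unfolding form_def sum_distrib_left
  by (intro sum.cong) (auto simp: algebra_simps power2_eq_square)

lemma mass_linear: "mass k (\<lambda>x. c * \<phi> x + d * \<psi> x) = c * mass k \<phi> + d * mass k \<psi>"
  unfolding mass_def sum_distrib_left sum.distrib[symmetric]
  by (intro sum.cong) (auto simp: algebra_simps)

lemma mass_const_pos: "k \<in> {0..K} \<Longrightarrow> 0 < mass k (\<lambda>_. 1)"
  unfolding mass_def using finite_S S_nonempty \<tau>_pos by (intro sum_pos) auto

definition recentred :: "real \<Rightarrow> ('x \<Rightarrow> real) \<Rightarrow> 'x \<Rightarrow> real" where
  "recentred k \<phi> x = \<phi> x - mass k \<phi> / mass k (\<lambda>_. 1)"

lemma mass_recentred: "k \<in> {0..K} \<Longrightarrow> mass k (recentred k \<phi>) = 0"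
  using mass_linear[of k 1 \<phi> "- (mass k \<phi> / mass k (\<lambda>_. 1))" "\<lambda>_. 1"] mass_const_pos[of k]
  by (simp add: recentred_def[abs_def])

lemma form_cong:
  assumes "\<And>x. x \<in> nodes \<Longrightarrow> \<phi> x = \<psi> x"
  shows "form k \<phi> \<phi> = form k \<psi> \<psi>"
  unfolding form_def using assms ends_in_nodes by (intro sum.cong) auto

lemma mass_cong:
  assumes "\<And>x. x \<in> nodes \<Longrightarrow> \<phi> x = \<psi> x"
  shows "mass k \<phi> = mass k \<psi>"
  unfolding mass_def using assms ends_in_nodes by (intro sum.cong) auto

text \<open>
  Functions are set to zero away from the nodes and normalized, so that this set is compact in the
  product topology.
\<close>

definition admissible :: "(real \<times> ('x \<Rightarrow> real)) set" where
  "admissible = {(k, \<phi>). k \<in> {0..K} \<and> (\<forall>x. x \<notin> nodes \<longrightarrow> \<phi> x = 0) \<and> (\<Sum>x\<in>nodes. (\<phi> x)\<^sup>2) = 1 \<and>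
     mass k \<phi> = 0 \<and> form k \<phi> \<phi> \<le> 0}"

lemma admissible_normalize:
  assumes k: "k \<in> {0..K}" and m: "mass k \<phi> = 0" and f: "form k \<phi> \<phi> \<le> 0"
    and x: "x \<in> nodes" "\<phi> x \<noteq> 0"
  shows "\<exists>\<psi>. (k, \<psi>) \<in> admissible"
proof -
  define N where "N = (\<Sum>x\<in>nodes. (\<phi> x)\<^sup>2)"
  have N: "N > 0"
    unfolding N_def by (rule sum_pos2[of nodes x]) (use finite_nodes x in auto)
  define \<psi> where "\<psi> y = (if y \<in> nodes then 1 / sqrt N * \<phi> y else 0)" for y
  have "mass k \<psi> = mass k (\<lambda>x. 1 / sqrt N * \<phi> x)"
    by (rule mass_cong) (auto simp: \<psi>_def)
  also have "\<dots> = 0"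
    using mass_linear[of k "1 / sqrt N" \<phi> 0 \<phi>] m by simp
  finally have 1: "mass k \<psi> = 0" .
  have "form k \<psi> \<psi> = form k (\<lambda>x. 1 / sqrt N * \<phi> x) (\<lambda>x. 1 / sqrt N * \<phi> x)"
    by (rule form_cong) (auto simp: \<psi>_def)
  also have "\<dots> = (1 / sqrt N)\<^sup>2 * form k \<phi> \<phi>" by (rule form_scale)
  also have "\<dots> \<le> 0" using f by (intro mult_nonneg_nonpos) auto
  finally have 2: "form k \<psi> \<psi> \<le> 0" .
  have "(\<Sum>x\<in>nodes. (\<psi> x)\<^sup>2) = (\<Sum>x\<in>nodes. (\<phi> x)\<^sup>2 / N)"
    using N by (intro sum.cong) (auto simp: \<psi>_def power_divide)
  also have "\<dots> = 1" using N by (simp add: sum_divide_distrib[symmetric] N_def[symmetric])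
  finally show ?thesis using 1 2 k by (intro exI[of _ \<psi>]) (auto simp: admissible_def \<psi>_def)
qed

lemma continuous_on_form_mass:
  fixes p :: "'z :: topological_space \<Rightarrow> real" and q :: "'z \<Rightarrow> 'x \<Rightarrow> real"
  assumes "continuous_on T p" "p ` T \<subseteq> {0..K}" "\<And>x. continuous_on T (\<lambda>z. q z x)"
  shows "continuous_on T (\<lambda>z. form (p z) (q z) (q z))" "continuous_on T (\<lambda>z. mass (p z) (q z))"
proof -
  have *: "continuous_on T (\<lambda>z. \<sigma> s (p z))" "continuous_on T (\<lambda>z. \<tau> s (p z))" if "s \<in> S" for s
    using continuous_on_compose2[OF \<sigma>_cont assms(1,2)] continuous_on_compose2[OF \<tau>_cont assms(1,2)] that
    by auto
  show "continuous_on T (\<lambda>z. form (p z) (q z) (q z))" "continuous_on T (\<lambda>z. mass (p z) (q z))"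
    unfolding form_def mass_def by (intro continuous_intros * assms; simp)+
qed

lemma compact_admissible: "compact admissible"
proof -
  define Box where "Box = (PiE UNIV (\<lambda>x. if x \<in> nodes then {-1..1} else {0::real}))"
  have "compactin (product_topology (\<lambda>_. euclidean) UNIV) Box"
    unfolding Box_def by (subst compactin_PiE) auto
  then have Box: "compact Box"
    by (simp add: euclidean_product_topology)
  define C where "C = {0..K} \<times> Box"
  have C: "compact C" unfolding C_def by (intro compact_Times Box) auto
  have cf: "continuous_on C fst" by (intro continuous_intros)
  have cs: "continuous_on C (\<lambda>z. snd z x)" for x
  proof -
    have "continuous_on C (\<lambda>z. snd z)" by (intro continuous_intros)
    then show ?thesis by (rule continuous_on_product_then_coordinatewise)
  qed
  have sub: "fst ` C \<subseteq> {0..K}" by (auto simp: C_def)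
  have c1: "continuous_on C (\<lambda>z. \<Sum>x\<in>nodes. (snd z x)\<^sup>2)"
    by (intro continuous_intros cs)
  note c23 = continuous_on_form_mass[OF cf sub cs]
  have eq: "admissible = (C \<inter> (\<lambda>z. \<Sum>x\<in>nodes. (snd z x)\<^sup>2) -` {1}) \<inter>
      ((C \<inter> (\<lambda>z. mass (fst z) (snd z)) -` {0}) \<inter>
      (C \<inter> (\<lambda>z. form (fst z) (snd z) (snd z)) -` {..0}))" (is "_ = ?R")
  proof
    show "?R \<subseteq> admissible"
      by (auto simp: C_def Box_def admissible_def PiE_def Pi_def)
    show "admissible \<subseteq> ?R"
    proof
      fix z assume z: "z \<in> admissible"
      obtain k \<phi> where [simp]: "z = (k, \<phi>)" by (cases z)
      have "\<bar>\<phi> x\<bar> \<le> 1" if "x \<in> nodes" for x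
      proof -
        have "(\<phi> x)\<^sup>2 \<le> (\<Sum>x\<in>nodes. (\<phi> x)\<^sup>2)"
          by (rule member_le_sum) (use that finite_nodes in auto)
        then show ?thesis using z by (simp add: admissible_def abs_square_le_1)
      qed
      then show "z \<in> ?R" using z
        by (auto simp: C_def Box_def admissible_def abs_le_iff minus_le_iff)
    qed
  qed
  have "closedin (top_of_set C) admissible"
    unfolding eq by (intro closedin_Int continuous_closedin_preimage c1 c23) auto
  then show ?thesis by (rule closedin_compact[OF C])
qed

text \<open>
  Let \<open>k\<close> be minimal such that some \<open>(k, \<phi>)\<close> is admissible. If \<open>g = vertex_op k \<phi>\<close> were nonzero, moving
  \<open>\<phi>\<close> against its gradient \<open>g\<close>, corrected by a constant to preserve mass zero, would make the form
  negative. By continuity the form stays negative for slightly smaller \<open>k\<close> (after recentring, as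
  the mass depends on \<open>k\<close>), against minimality.
\<close>

lemma kernel_exists:
  assumes m: "mass K \<phi>0 = 0" and f: "form K \<phi>0 \<phi>0 \<le> 0" and x: "x \<in> nodes" "\<phi>0 x \<noteq> 0"
  obtains k \<phi> y where "0 < k" "k \<le> K" "y \<in> nodes" "\<phi> y \<noteq> 0" "\<And>x. x \<in> nodes \<Longrightarrow> vertex_op k \<phi> x = 0"
proof -
  have "admissible \<noteq> {}"
    using admissible_normalize[OF _ m f x] K_pos by auto
  moreover have "continuous_on admissible fst" by (intro continuous_intros)
  ultimately obtain z where z: "z \<in> admissible" "\<And>w. w \<in> admissible \<Longrightarrow> fst z \<le> fst w"
    using continuous_attains_inf[OF compact_admissible, of fst] by blast
  obtain k \<phi> where z_eq: "z = (k, \<phi>)" by (cases z)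
  have k: "k \<in> {0..K}" and sum1: "(\<Sum>x\<in>nodes. (\<phi> x)\<^sup>2) = 1" and m0: "mass k \<phi> = 0" and f0: "form k \<phi> \<phi> \<le> 0"
    using z(1) by (auto simp: z_eq admissible_def)
  have k_min: "k \<le> k'" if "(k', \<psi>) \<in> admissible" for k' \<psi>
    using z(2)[OF that] by (simp add: z_eq)
  obtain y where y: "y \<in> nodes" "\<phi> y \<noteq> 0"
    using sum1 by (metis (no_types, lifting) power_zero_numeral sum.neutral zero_neq_one)
  \<comment> \<open>At \<open>k = 0\<close> the form is a sum of squares, so \<open>\<phi>\<close> is constant, of mass zero and nonzero.\<close>
  have "k \<noteq> 0"
  proof
    assume k0: "k = 0"
    have nn: "0 \<le> \<sigma> s 0 * (\<phi> (a s) - \<phi> (b s))\<^sup>2" if "s \<in> S" for s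
      using \<sigma>_pos[OF that, of 0] K_pos by simp
    have "(\<Sum>s\<in>S. \<sigma> s 0 * (\<phi> (a s) - \<phi> (b s))\<^sup>2) = form 0 \<phi> \<phi>"
      unfolding form_def by (intro sum.cong) (auto simp: power2_eq_square)
    then have "(\<Sum>s\<in>S. \<sigma> s 0 * (\<phi> (a s) - \<phi> (b s))\<^sup>2) = 0"
      using f0 k0 sum_nonneg[of S "\<lambda>s. \<sigma> s 0 * (\<phi> (a s) - \<phi> (b s))\<^sup>2"] nn by simp
    then have "\<sigma> s 0 * (\<phi> (a s) - \<phi> (b s))\<^sup>2 = 0" if "s \<in> S" for s
      using sum_nonneg_eq_0_iff[of S "\<lambda>s. \<sigma> s 0 * (\<phi> (a s) - \<phi> (b s))\<^sup>2"] nn finite_S that by blast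
    then have eq: "\<phi> (a s) = \<phi> (b s)" if "s \<in> S" for s
      using \<sigma>_pos[OF that, of 0] that K_pos by fastforce
    have c: "\<phi> x = \<phi> y" if "x \<in> nodes" for x
      using constant_on_nodes[of \<phi>, OF eq that y(1)] by simp
    have "mass 0 \<phi> = mass 0 (\<lambda>x. \<phi> y * 1 + 0 * 1)"
      by (rule mass_cong) (use c in auto)
    also have "\<dots> = \<phi> y * mass 0 (\<lambda>_. 1)"
      by (subst mass_linear) simp
    finally show False using m0 k0 y(2) mass_const_pos[of 0] K_pos by auto
  qed
  then have k_pos: "0 < k" using k by simp
  have "vertex_op k \<phi> x = 0" if "x \<in> nodes" for x
  proof (rule ccontr)
    assume nz: "vertex_op k \<phi> x \<noteq> 0"
    define g where "g = vertex_op k \<phi>"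
    define G where "G = (\<Sum>x\<in>nodes. (g x)\<^sup>2)"
    have G: "0 < G" unfolding G_def
      by (rule sum_pos2[of nodes x]) (use finite_nodes that nz in \<open>auto simp: g_def\<close>)
    define c where "c = mass k g / mass k (\<lambda>_. 1)"
    define w where "w x = c - g x" for x
    have mw: "mass k w = 0"
      using mass_linear[of k c "\<lambda>_. 1" "-1" g] mass_const_pos[OF k]
      by (simp add: w_def[abs_def] c_def)
    have fg: "form k \<phi> g = G"
      by (simp add: form_eq_vertex_op G_def g_def power2_eq_square)
    have fw: "form k \<phi> w = - G"
      unfolding w_def[abs_def] form_diff form_const m0 fg by simp
    \<comment> \<open>A step so small that the first-order decrease \<open>2eG\<close> beats the second-order term.\<close>
    define e where "e = G / (\<bar>form k w w\<bar> + 1)"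
    have e: "0 < e" using G by (simp add: e_def add_nonneg_pos)
    have "e * form k w w \<le> e * (\<bar>form k w w\<bar> + 1)" using e by (intro mult_left_mono) auto
    also have "\<dots> = G" by (simp add: e_def add_nonneg_pos less_imp_neq[symmetric])
    finally have "e * form k w w - 2 * G < 0" using G by simp
    then have "e * (e * form k w w - 2 * G) < 0" using e by (simp add: mult_pos_neg)
    define \<psi> where "\<psi> x = \<phi> x + e * w x" for x
    have m\<psi>: "mass k \<psi> = 0"
      using mass_linear[of k 1 \<phi> e w] m0 mw by (simp add: \<psi>_def[abs_def])
    have f\<psi>: "form k \<psi> \<psi> < 0"
      unfolding \<psi>_def[abs_def] form_perturb fw
      using f0 \<open>e * (e * form k w w - 2 * G) < 0\<close> by (simp add: algebra_simps power2_eq_square)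
    \<comment> \<open>Lower \<open>k\<close> slightly, recentring \<open>\<psi>\<close> to keep mass zero.\<close>
    define r where "r k' = form k' (recentred k' \<psi>) (recentred k' \<psi>)" for k'
    have rc: "continuous_on {0..K} (\<lambda>k'. recentred k' \<psi> x)" for x
      unfolding recentred_def using mass_const_pos
      by (intro continuous_intros continuous_on_form_mass) (auto, metis less_irrefl atLeastAtMost_iff)
    have "continuous_on {0..K} r" unfolding r_def
      by (intro continuous_on_form_mass rc continuous_intros) auto
    moreover have "r k < 0" using f\<psi> m\<psi> by (simp add: r_def recentred_def[abs_def])
    ultimately obtain d where d: "d > 0" "\<And>k'. k' \<in> {0..K} \<Longrightarrow> dist k' k < d \<Longrightarrow> dist (r k') (r k) < - r k"
      using k unfolding continuous_on_iff by (metis neg_0_less_iff_less)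
    define k' where "k' = max (k / 2) (k - d / 2)"
    have k': "k' \<in> {0..K}" "k' < k" "dist k' k < d"
      using k k_pos d(1) by (auto simp: k'_def dist_real_def max_def field_simps)
    have rneg: "r k' < 0" using d(2)[OF k'(1,3)] by (simp add: dist_real_def abs_less_iff)
    have "\<exists>x\<in>nodes. recentred k' \<psi> x \<noteq> 0"
    proof (rule ccontr)
      assume "\<not> ?thesis"
      then have "r k' = form k' (\<lambda>_. 0) (\<lambda>_. 0)" unfolding r_def by (intro form_cong) auto
      then show False using rneg by (simp add: form_def)
    qed
    then obtain \<theta> where "(k', \<theta>) \<in> admissible"
      using admissible_normalize[OF k'(1) mass_recentred[OF k'(1)]] rneg unfolding r_def by (metis less_imp_le)
    then show False using k_min k'(2) by fastforce
  qed
  then show ?thesis using that k_pos k y by auto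
qed

end

section \<open>Classical eigenfunctions and nonnegativity of eigenvalues\<close>

lemma H2_intervalD:
  assumes "H2_interval l u u' u''"
  shows "x \<in> {0..l} \<Longrightarrow> (u has_vector_derivative u' x) (at x within {0..l})"
    and "set_borel_measurable lborel {0..l} u''"
    and "x \<in> {0..l} \<Longrightarrow> u' x = u' 0 + (LINT t:{0..x}|lborel. u'' t)"
  using assms unfolding H2_interval_def by - (elim conjE, (erule (1) bspec | assumption))+

text \<open>
  Regularity: the second derivative of an eigenfunction agrees almost everywhere with the
  continuous function \<open>-\<mu>u\<close>, so the integral that represents \<open>u'\<close> is differentiable everywhere.
\<close>

lemma H2_interval_eigen_ode:
  assumes H2: "H2_interval l u u' u''"
    and ae: "AE x\<in>{0..l} in lborel. complex_of_real \<mu> * u x = - u'' x"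
    and x: "x \<in> {0..l}"
  shows "(u' has_vector_derivative - complex_of_real \<mu> * u x) (at x within {0..l})"
proof -
  define g where "g t = - complex_of_real \<mu> * u t" for t
  have u: "(u has_vector_derivative u' x) (at x within {0..l})" if "x \<in> {0..l}" for x
    by (rule H2_intervalD(1)[OF H2 that])
  have cont_u: "continuous_on {0..l} u"
    using u by (meson continuous_on_eq_continuous_within has_vector_derivative_continuous)
  have cont: "continuous_on {0..l} g"
    unfolding g_def by (intro continuous_intros cont_u)
  have rep: "u' y = u' 0 + integral {0..y} g" if y: "y \<in> {0..l}" for y
  proof -
    have sub: "{0..y} \<subseteq> {0..l}" using y by auto
    have int: "set_integrable lborel {0..y} g"
      by (intro borel_integrable_atLeastAtMost' continuous_on_subset[OF cont sub])
    have m: "set_borel_measurable lborel {0..y} u''"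
      by (rule set_borel_measurable_subset[OF H2_intervalD(2)[OF H2] _ sub]) simp
    have "(LINT t:{0..y}|lborel. u'' t) = (LINT t:{0..y}|lborel. g t)"
      unfolding set_lebesgue_integral_def
    proof (rule integral_cong_AE)
      show "(\<lambda>t. indicat_real {0..y} t *\<^sub>R u'' t) \<in> borel_measurable lborel"
        using m by (simp add: set_borel_measurable_def)
      show "(\<lambda>t. indicat_real {0..y} t *\<^sub>R g t) \<in> borel_measurable lborel"
        using int by (simp add: set_integrable_def)
      show "AE t in lborel. indicat_real {0..y} t *\<^sub>R u'' t = indicat_real {0..y} t *\<^sub>R g t"
        using ae
      proof (rule AE_mp, intro AE_I2 impI)
        fix t assume "t \<in> {0..l} \<longrightarrow> complex_of_real \<mu> * u t = - u'' t"
        then show "indicat_real {0..y} t *\<^sub>R u'' t = indicat_real {0..y} t *\<^sub>R g t"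
          using sub by (auto simp: g_def indicator_def)
      qed
    qed
    also have "\<dots> = integral {0..y} g"
      by (rule set_borel_integral_eq_integral(2)[OF int])
    moreover have "u' y = u' 0 + (LINT t:{0..y}|lborel. u'' t)"
      by (rule H2_intervalD(3)[OF H2 y])
    ultimately show ?thesis by (simp only:)
  qed
  have "((\<lambda>y. u' 0 + integral {0..y} g) has_vector_derivative 0 + g x) (at x within {0..l})"
    by (intro has_vector_derivative_add has_vector_derivative_const integral_has_vector_derivative cont x)
  then have "(u' has_vector_derivative 0 + g x) (at x within {0..l})"
    using x rep by (rule has_vector_derivative_transform[rotated 2])
  then show ?thesis by (simp add: g_def)
qed

lemma eigen_ode_H2_interval:
  assumes u: "\<And>x. x \<in> {0..l} \<Longrightarrow> (u has_vector_derivative u' x) (at x within {0..l})"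
    and u': "\<And>x. x \<in> {0..l} \<Longrightarrow>
      (u' has_vector_derivative - complex_of_real \<mu> * u x) (at x within {0..l})"
  shows "H2_interval l u u' (\<lambda>x. - complex_of_real \<mu> * u x)"
proof -
  have cont_u: "continuous_on {0..l} u"
    using u by (meson continuous_on_eq_continuous_within has_vector_derivative_continuous)
  define g where "g t = - complex_of_real \<mu> * u t" for t
  have cont: "continuous_on {0..l} g"
    unfolding g_def by (intro continuous_intros cont_u)
  have int: "set_integrable lborel {0..l} g"
    by (intro borel_integrable_atLeastAtMost' cont)
  have int2: "set_integrable lborel {0..l} (\<lambda>x. (cmod (g x))\<^sup>2)"
    by (intro borel_integrable_atLeastAtMost' continuous_intros cont)
  have "u' x = u' 0 + (LINT t:{0..x}|lborel. g t)" if x: "x \<in> {0..l}" for x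
  proof -
    have sub: "{0..x} \<subseteq> {0..l}" using x by auto
    have "(LINT t:{0..x}|lborel. g t) = u' x - u' 0"
      unfolding set_lebesgue_integral_def
    proof (rule integral_FTC_atLeastAtMost)
      show "(u' has_vector_derivative g y) (at y within {0..x})" if "0 \<le> y" "y \<le> x" for y
        using u'[of y] that x by (auto simp: g_def intro: has_vector_derivative_within_subset[OF _ sub])
    qed (use x continuous_on_subset[OF cont sub] in auto)
    then show ?thesis by simp
  qed
  moreover have "set_borel_measurable lborel {0..l} g"
    using int unfolding set_borel_measurable_def set_integrable_def by (rule borel_measurable_integrable)
  ultimately have "H2_interval l u u' g"
    unfolding H2_interval_def using u int2 by (intro conjI ballI)
  then show ?thesis by (simp add: g_def[abs_def])
qed

definition classical_eigenfunction :: "('v, 'e) pre_digraph \<Rightarrow> ('e \<Rightarrow> real) \<Rightarrow> real \<Rightarrow>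
    ('e \<Rightarrow> real \<Rightarrow> complex) \<Rightarrow> ('e \<Rightarrow> real \<Rightarrow> complex) \<Rightarrow> bool" where
  "classical_eigenfunction G len \<mu> f f' \<longleftrightarrow>
     (\<forall>e x. \<not> (e \<in> arcs G \<and> x \<in> {0..len e}) \<longrightarrow> f e x = 0) \<and>
     (\<forall>v\<in>verts G. continuous_at_vertex G len f v) \<and>
     (\<forall>v\<in>verts G. kirchhoff_at_vertex G len f' v) \<and>
     (\<forall>e\<in>arcs G. \<forall>x\<in>{0..len e}.
        (f e has_vector_derivative f' e x) (at x within {0..len e}) \<and>
        (f' e has_vector_derivative - complex_of_real \<mu> * f e x) (at x within {0..len e}))"

lemma classical_eigenfunctionD:
  assumes "classical_eigenfunction G len \<mu> f f'"
  shows "\<not> (e \<in> arcs G \<and> x \<in> {0..len e}) \<Longrightarrow> f e x = 0"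
    and "v \<in> verts G \<Longrightarrow> continuous_at_vertex G len f v"
    and "v \<in> verts G \<Longrightarrow> kirchhoff_at_vertex G len f' v"
    and "e \<in> arcs G \<Longrightarrow> x \<in> {0..len e} \<Longrightarrow>
      (f e has_vector_derivative f' e x) (at x within {0..len e})"
    and "e \<in> arcs G \<Longrightarrow> x \<in> {0..len e} \<Longrightarrow>
      (f' e has_vector_derivative - complex_of_real \<mu> * f e x) (at x within {0..len e})"
  using assms unfolding classical_eigenfunction_def by blast+

lemma eigenspace_iff_classical:
  "f \<in> eigenspace G len \<mu> \<longleftrightarrow> (\<exists>f'. classical_eigenfunction G len \<mu> f f')"
proof
  assume "f \<in> eigenspace G len \<mu>"
  then obtain f' f'' where *:
      "\<forall>e x. \<not> (e \<in> arcs G \<and> x \<in> {0..len e}) \<longrightarrow> f e x = 0"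
      "\<forall>v\<in>verts G. continuous_at_vertex G len f v"
      "\<forall>v\<in>verts G. kirchhoff_at_vertex G len f' v"
      "\<And>e. e \<in> arcs G \<Longrightarrow> H2_interval (len e) (f e) (f' e) (f'' e)"
      "\<And>e. e \<in> arcs G \<Longrightarrow> AE x\<in>{0..len e} in lborel. complex_of_real \<mu> * f e x = - f'' e x"
    unfolding eigenspace_def std_laplacian_def by blast
  have "(f e has_vector_derivative f' e x) (at x within {0..len e}) \<and>
      (f' e has_vector_derivative - complex_of_real \<mu> * f e x) (at x within {0..len e})"
    if "e \<in> arcs G" "x \<in> {0..len e}" for e x
    using H2_interval_eigen_ode[OF *(4)[OF that(1)] *(5)[OF that(1)] that(2)]
      H2_intervalD(1)[OF *(4)[OF that(1)] that(2)] by (rule conjI[rotated])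
  with *(1-3) show "\<exists>f'. classical_eigenfunction G len \<mu> f f'"
    unfolding classical_eigenfunction_def by blast
next
  assume "\<exists>f'. classical_eigenfunction G len \<mu> f f'"
  then obtain f' where *: "classical_eigenfunction G len \<mu> f f'" ..
  let ?f'' = "\<lambda>e x. - complex_of_real \<mu> * f e x"
  have "H2_interval (len e) (f e) (f' e) (?f'' e)" if "e \<in> arcs G" for e
    by (rule eigen_ode_H2_interval) (rule classical_eigenfunctionD(4,5)[OF * that], assumption)+
  moreover have "AE x\<in>{0..len e} in lborel. complex_of_real \<mu> * f e x = - ?f'' e x" for e
    by simp
  ultimately have "\<exists>f'' . (\<forall>e\<in>arcs G. H2_interval (len e) (f e) (f' e) (f'' e)) \<and>
      (\<forall>v\<in>verts G. kirchhoff_at_vertex G len f' v) \<and>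
      (\<forall>e\<in>arcs G. AE x\<in>{0..len e} in lborel. complex_of_real \<mu> * f e x = - f'' e x)"
    using classical_eigenfunctionD(3)[OF *] by (intro exI[of _ ?f''] conjI ballI)
  then show "f \<in> eigenspace G len \<mu>"
    unfolding eigenspace_def std_laplacian_def mem_Collect_eq
    using classical_eigenfunctionD(1,2)[OF *] by blast
qed

context metric_graph
begin

lemma sum_over_vertices:
  "(\<Sum>v\<in>verts G. \<Sum>e\<in>out_arcs G v. A e) = (\<Sum>e\<in>arcs G. A e)"
  "(\<Sum>v\<in>verts G. \<Sum>e\<in>in_arcs G v. A e) = (\<Sum>e\<in>arcs G. A e)"
proof -
  have "(\<Sum>v\<in>verts G. \<Sum>e | e \<in> arcs G \<and> tail G e = v. A e) = (\<Sum>e\<in>arcs G. A e)"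
    by (rule sum.group) auto
  then show "(\<Sum>v\<in>verts G. \<Sum>e\<in>out_arcs G v. A e) = (\<Sum>e\<in>arcs G. A e)"
    by (simp add: out_arcs_def)
  have "(\<Sum>v\<in>verts G. \<Sum>e | e \<in> arcs G \<and> head G e = v. A e) = (\<Sum>e\<in>arcs G. A e)"
    by (rule sum.group) auto
  then show "(\<Sum>v\<in>verts G. \<Sum>e\<in>in_arcs G v. A e) = (\<Sum>e\<in>arcs G. A e)"
    by (simp add: in_arcs_def)
qed

text \<open>
  At each vertex \<open>cnj f\<close> is a common factor of the boundary terms and the normal derivatives add up
  to zero.
\<close>

lemma boundary_terms_cancel:
  assumes f: "classical_eigenfunction G len \<mu> f f'"
  shows "(\<Sum>e\<in>arcs G. cnj (f e (len e)) * f' e (len e) - cnj (f e 0) * f' e 0) = 0"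
proof -
  define A where "A e = cnj (f e 0) * f' e 0" for e
  define B where "B e = cnj (f e (len e)) * f' e (len e)" for e
  have "(\<Sum>e\<in>out_arcs G v. A e) - (\<Sum>e\<in>in_arcs G v. B e) = 0" if v: "v \<in> verts G" for v
  proof -
    obtain c where c: "\<forall>e\<in>out_arcs G v. f e 0 = c" "\<forall>e\<in>in_arcs G v. f e (len e) = c"
      using classical_eigenfunctionD(2)[OF f v] unfolding continuous_at_vertex_def by blast
    have "(\<Sum>e\<in>out_arcs G v. A e) = cnj c * (\<Sum>e\<in>out_arcs G v. f' e 0)"
      unfolding sum_distrib_left using c by (intro sum.cong) (auto simp: A_def)
    moreover have "(\<Sum>e\<in>in_arcs G v. B e) = cnj c * (\<Sum>e\<in>in_arcs G v. f' e (len e))"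
      unfolding sum_distrib_left using c by (intro sum.cong) (auto simp: B_def)
    ultimately have "(\<Sum>e\<in>out_arcs G v. A e) - (\<Sum>e\<in>in_arcs G v. B e) =
        cnj c * ((\<Sum>e\<in>out_arcs G v. f' e 0) + (\<Sum>e\<in>in_arcs G v. - f' e (len e)))"
      by (simp add: sum_negf right_diff_distrib)
    then show ?thesis
      using classical_eigenfunctionD(3)[OF f v] by (simp only: kirchhoff_at_vertex_def mult_zero_right)
  qed
  then have "(\<Sum>v\<in>verts G. (\<Sum>e\<in>out_arcs G v. A e) - (\<Sum>e\<in>in_arcs G v. B e)) = 0"
    by (intro sum.neutral ballI)
  then have "(\<Sum>e\<in>arcs G. A e) - (\<Sum>e\<in>arcs G. B e) = 0"
    using sum_over_vertices(1)[of A] sum_over_vertices(2)[of B] by (simp only: sum_subtractf)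
  then show ?thesis by (simp only: A_def B_def sum_subtractf) (simp only: right_minus_eq)
qed

text \<open>
  Integrating \<open>(cnj f \<cdot> f')' = \<bar>f'\<bar>\<^sup>2 - \<mu>\<bar>f\<bar>\<^sup>2\<close> over all edges gives zero. If \<open>\<mu> < 0\<close>, the integrand is
  nonnegative and forces \<open>f = 0\<close>.
\<close>

lemma eigenvalue_nonneg:
  assumes "\<mu> \<in> eigenvalues G len"
  shows "0 \<le> \<mu>"
proof (rule ccontr)
  assume neg: "\<not> 0 \<le> \<mu>"
  obtain f where "f \<in> eigenspace G len \<mu>" and nz: "f \<noteq> 0"
    using assms unfolding eigenvalues_def by blast
  then obtain f' where f: "classical_eigenfunction G len \<mu> f f'"
    using eigenspace_iff_classical by blast
  define w where "w e x = Re (cnj (f e x) * f' e x)" for e x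
  define h where "h e x = (cmod (f' e x))\<^sup>2 - \<mu> * (cmod (f e x))\<^sup>2" for e x
  have fd: "(f e has_vector_derivative f' e x) (at x within {0..len e})"
      "(f' e has_vector_derivative - complex_of_real \<mu> * f e x) (at x within {0..len e})"
      if "e \<in> arcs G" "x \<in> {0..len e}" for e x
    using classical_eigenfunctionD(4,5)[OF f that] .
  have h_nonneg: "0 \<le> h e x" for e x
  proof -
    have "\<mu> * (cmod (f e x))\<^sup>2 \<le> 0" using neg by (intro mult_nonpos_nonneg) auto
    then show ?thesis by (simp add: h_def add_increasing2 diff_ge_0_iff_ge order_trans[of _ 0])
  qed
  have wd: "(w e has_vector_derivative h e x) (at x within {0..len e})"
    if "e \<in> arcs G" "x \<in> {0..len e}" for e x
  proof -
    have "((\<lambda>x. cnj (f e x)) has_vector_derivative cnj (f' e x)) (at x within {0..len e})"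
      by (rule bounded_linear.has_vector_derivative[OF bounded_linear_cnj fd(1)[OF that]])
    then have "((\<lambda>x. cnj (f e x) * f' e x) has_vector_derivative
        cnj (f e x) * (- complex_of_real \<mu> * f e x) + cnj (f' e x) * f' e x) (at x within {0..len e})"
      using fd(2)[OF that] by (rule has_vector_derivative_mult)
    then have "((\<lambda>x. Re (cnj (f e x) * f' e x)) has_vector_derivative
        Re (cnj (f e x) * (- complex_of_real \<mu> * f e x) + cnj (f' e x) * f' e x)) (at x within {0..len e})"
      by (rule bounded_linear.has_vector_derivative[OF bounded_linear_Re])
    moreover have "Re (cnj (f e x) * (- complex_of_real \<mu> * f e x) + cnj (f' e x) * f' e x) = h e x"
      unfolding h_def cmod_power2 by (simp add: algebra_simps power2_eq_square)
    ultimately show ?thesis by (simp add: w_def[abs_def])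
  qed
  have hi: "(h e has_integral (w e (len e) - w e 0)) {0..len e}" if "e \<in> arcs G" for e
    by (rule fundamental_theorem_of_calculus[OF less_imp_le[OF len_pos[OF that]] wd[OF that]])
  have "(\<Sum>e\<in>arcs G. w e (len e) - w e 0) =
      Re (\<Sum>e\<in>arcs G. cnj (f e (len e)) * f' e (len e) - cnj (f e 0) * f' e 0)"
    by (simp only: w_def Re_sum minus_complex.sel)
  then have "(\<Sum>e\<in>arcs G. w e (len e) - w e 0) = 0"
    by (simp only: boundary_terms_cancel[OF f] zero_complex.sel)
  moreover have "0 \<le> w e (len e) - w e 0" if "e \<in> arcs G" for e
    using has_integral_nonneg[OF hi[OF that] h_nonneg] .
  ultimately have "w e (len e) - w e 0 = 0" if "e \<in> arcs G" for e
    using sum_nonneg_eq_0_iff[of "arcs G" "\<lambda>e. w e (len e) - w e 0"] that finite_arcs by blast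
  then have "integral {0..len e} (h e) = 0" if "e \<in> arcs G" for e
    using integral_unique[OF hi[OF that]] that by simp
  moreover have "continuous_on {0..len e} (h e)" if "e \<in> arcs G" for e
  proof -
    have "continuous_on {0..len e} (f e)" "continuous_on {0..len e} (f' e)"
      using fd[OF that] by (meson continuous_on_eq_continuous_within has_vector_derivative_continuous)+
    then show ?thesis unfolding h_def by (intro continuous_intros)
  qed
  ultimately have h0: "h e x = 0" if "e \<in> arcs G" "x \<in> {0..len e}" for e x
    using integral_eq_0_iff[of 0 "len e" "h e"] len_pos h_nonneg that by auto
  have "f e x = 0" for e x
  proof (cases "e \<in> arcs G \<and> x \<in> {0..len e}")
    case True
    then have "(cmod (f' e x))\<^sup>2 = \<mu> * (cmod (f e x))\<^sup>2" using h0[of e x] by (simp add: h_def)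
    then have "0 \<le> \<mu> * (cmod (f e x))\<^sup>2" by (metis zero_le_power2)
    then show ?thesis using neg by (simp add: zero_le_mult_iff)
  next
    case False
    then show ?thesis by (rule classical_eigenfunctionD(1)[OF f])
  qed
  then have "f = 0" by (simp add: fun_eq_iff)
  with nz show False ..
qed

end

section \<open>Explicit solutions and multiplicities\<close>

text \<open>
  The fundamental system of \<open>u'' = -k\<^sup>2u\<close> at \<open>0\<close>, in a normalization that includes \<open>k = 0\<close>.
\<close>

definition edge_cos :: "real \<Rightarrow> real \<Rightarrow> real" where "edge_cos k x = cos (k * x)"

definition edge_sin :: "real \<Rightarrow> real \<Rightarrow> real" where
  "edge_sin k x = (if k = 0 then x else sin (k * x) / k)"

lemma edge_cos_deriv: "(edge_cos k has_real_derivative - k\<^sup>2 * edge_sin k x) (at x within A)"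
  unfolding edge_cos_def[abs_def] edge_sin_def
  by (auto intro!: derivative_eq_intros simp: power2_eq_square)

lemma edge_sin_deriv: "(edge_sin k has_real_derivative edge_cos k x) (at x within A)"
  unfolding edge_cos_def edge_sin_def[abs_def]
  by (cases "k = 0") (auto intro!: derivative_eq_intros)

lemma edge_cos_sin_identity: "(edge_cos k x)\<^sup>2 + k\<^sup>2 * (edge_sin k x)\<^sup>2 = 1"
  by (simp add: edge_cos_def edge_sin_def power_divide)

lemma edge_cos_sin_0 [simp]: "edge_cos k 0 = 1" "edge_sin k 0 = 0"
  by (simp_all add: edge_cos_def edge_sin_def)

text \<open>
  The Wronskians \<open>W1\<close> and \<open>W2\<close> of \<open>u\<close> with the fundamental system are constant, hence equal to the
  initial data; solving for \<open>u\<close> uses \<open>edge_cos_sin_identity\<close>.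
\<close>

lemma eigen_ode_solution:
  assumes u: "\<And>x. x \<in> {0..l} \<Longrightarrow> (u has_vector_derivative u' x) (at x within {0..l})"
    and u': "\<And>x. x \<in> {0..l} \<Longrightarrow>
      (u' has_vector_derivative - complex_of_real (k\<^sup>2) * u x) (at x within {0..l})"
    and x: "x \<in> {0..l}"
  shows "u x = u 0 * edge_cos k x + u' 0 * edge_sin k x"
proof -
  define c s where "c = edge_cos k" and "s = edge_sin k"
  define W1 where "W1 x = c x *\<^sub>R u' x + (k\<^sup>2 * s x) *\<^sub>R u x" for x
  define W2 where "W2 x = c x *\<^sub>R u x - s x *\<^sub>R u' x" for x
  have c: "(c has_real_derivative - k\<^sup>2 * s y) (at y within {0..l})"
    and s: "(s has_real_derivative c y) (at y within {0..l})" for y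
    unfolding c_def s_def by (rule edge_cos_deriv edge_sin_deriv)+
  have s2: "((\<lambda>y. k\<^sup>2 * s y) has_real_derivative k\<^sup>2 * c y) (at y within {0..l})" for y
    by (rule DERIV_cmult[OF s])
  have "(W1 has_vector_derivative 0) (at y within {0..l})" if y: "y \<in> {0..l}" for y
  proof -
    have "(W1 has_vector_derivative
        (c y *\<^sub>R (- complex_of_real (k\<^sup>2) * u y) + (- k\<^sup>2 * s y) *\<^sub>R u' y) +
        ((k\<^sup>2 * s y) *\<^sub>R u' y + (k\<^sup>2 * c y) *\<^sub>R u y)) (at y within {0..l})"
      unfolding W1_def[abs_def]
      by (intro has_vector_derivative_add has_vector_derivative_scaleR c s2 u[OF y] u'[OF y])
    then show ?thesis by (simp add: scaleR_conv_of_real algebra_simps)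
  qed
  then obtain w1 where w1: "\<And>y. y \<in> {0..l} \<Longrightarrow> W1 y = w1"
    using has_vector_derivative_zero_constant[of "{0..l}" W1] by auto
  have "(W2 has_vector_derivative 0) (at y within {0..l})" if y: "y \<in> {0..l}" for y
  proof -
    have "(W2 has_vector_derivative
        (c y *\<^sub>R u' y + (- k\<^sup>2 * s y) *\<^sub>R u y) -
        (s y *\<^sub>R (- complex_of_real (k\<^sup>2) * u y) + c y *\<^sub>R u' y)) (at y within {0..l})"
      unfolding W2_def[abs_def]
      by (intro has_vector_derivative_diff has_vector_derivative_scaleR c s u[OF y] u'[OF y])
    then show ?thesis by (simp add: scaleR_conv_of_real algebra_simps)
  qed
  then obtain w2 where w2: "\<And>y. y \<in> {0..l} \<Longrightarrow> W2 y = w2"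
    using has_vector_derivative_zero_constant[of "{0..l}" W2] by auto
  have "0 \<in> {0..l}" using x by auto
  then have "W1 x = u' 0" "W2 x = u 0"
    using w1[of 0] w2[of 0] w1[OF x] w2[OF x] by (auto simp: W1_def W2_def c_def s_def)
  then have "u 0 * c x + u' 0 * s x = c x *\<^sub>R W2 x + s x *\<^sub>R W1 x"
    by (simp add: scaleR_conv_of_real algebra_simps)
  also have "\<dots> = ((c x)\<^sup>2 + k\<^sup>2 * (s x)\<^sup>2) *\<^sub>R u x"
    by (simp add: W1_def W2_def scaleR_conv_of_real algebra_simps power2_eq_square)
  also have "\<dots> = u x"
    unfolding c_def s_def edge_cos_sin_identity by simp
  finally show ?thesis by (simp add: c_def s_def)
qed

context metric_graph
begin

text \<open>
  The dimension of an infinite-dimensional space is \<open>0\<close> by convention. Hence finite dimension is what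
  makes multiplicities positive.
\<close>

lemma eigenspace_finite_span:
  obtains B where "finite B" "eigenspace G len (k\<^sup>2) \<subseteq> edge_fun.span B"
proof
  define on_edge where "on_edge e p = (\<lambda>e' x. if e' = e \<and> x \<in> {0..len e} then complex_of_real (p k x) else 0)"
    for e p
  define B where "B = (\<lambda>e. on_edge e edge_cos) ` arcs G \<union> (\<lambda>e. on_edge e edge_sin) ` arcs G"
  show "finite B" by (simp add: B_def)
  show "eigenspace G len (k\<^sup>2) \<subseteq> edge_fun.span B"
  proof
    fix f assume "f \<in> eigenspace G len (k\<^sup>2)"
    then obtain f' where f: "classical_eigenfunction G len (k\<^sup>2) f f'"
      using eigenspace_iff_classical by blast
    define g where "g e = (\<lambda>e' x. f e 0 * on_edge e edge_cos e' x) + (\<lambda>e' x. f' e 0 * on_edge e edge_sin e' x)"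
      for e
    have g: "g e e' x = (if e' = e then (if x \<in> {0..len e} then f e x else 0) else 0)"
      if "e \<in> arcs G" for e e' x
      using eigen_ode_solution[OF classical_eigenfunctionD(4,5)[OF f that], symmetric]
      by (simp add: g_def on_edge_def)
    have sum_app: "(\<Sum>e\<in>A. g e) e' x = (\<Sum>e\<in>A. g e e' x)" if "finite A" for A e' x
      using that by induction auto
    define h where "h = (\<Sum>e\<in>arcs G. g e)"
    have "f e' x = h e' x" for e' x
    proof -
      have "(\<Sum>e\<in>arcs G. g e) e' x =
          (\<Sum>e\<in>arcs G. if e' = e then (if x \<in> {0..len e} then f e x else 0) else 0)"
        unfolding sum_app[OF finite_arcs] by (intro sum.cong refl g)
      also have "\<dots> = f e' x"
        using classical_eigenfunctionD(1)[OF f, of e' x] by (simp add: sum.delta)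
      finally show ?thesis unfolding h_def ..
    qed
    then have f_eq: "f = h" by (intro ext)
    have g_span: "g e \<in> edge_fun.span B" if "e \<in> arcs G" for e
    proof -
      have "on_edge e edge_cos \<in> edge_fun.span B" "on_edge e edge_sin \<in> edge_fun.span B"
        using that by (auto simp: B_def intro!: edge_fun.span_base)
      from edge_fun.span_add[OF edge_fun.span_scale[OF this(1), of "f e 0"] edge_fun.span_scale[OF this(2), of "f' e 0"]]
      show ?thesis by (simp only: g_def)
    qed
    have "h \<in> edge_fun.span B"
      unfolding h_def by (rule edge_fun.span_sum[where f = g]) (rule g_span)
    then show "f \<in> edge_fun.span B" unfolding f_eq .
  qed
qed

lemma multiplicity_pos:
  assumes "k\<^sup>2 \<in> eigenvalues G len"
  shows "1 \<le> multiplicity G len (k\<^sup>2)"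
proof -
  let ?V = "eigenspace G len (k\<^sup>2)"
  obtain f where f: "f \<in> ?V" "f \<noteq> 0"
    using assms unfolding eigenvalues_def by blast
  obtain C where C: "finite C" "?V \<subseteq> edge_fun.span C" by (rule eigenspace_finite_span)
  obtain B where B: "B \<subseteq> ?V" "edge_fun.independent B" "?V \<subseteq> edge_fun.span B" "card B = edge_fun.dim ?V"
    by (rule edge_fun.basis_exists)
  have "finite B"
    using edge_fun.independent_span_bound[OF C(1) B(2)] B(1) C(2) by blast
  moreover have "B \<noteq> {}" using B(3) f by auto
  ultimately have "0 < card B" by (simp add: card_gt_0_iff)
  then show ?thesis by (simp add: multiplicity_def B(4))
qed

lemma eigenvalue_of_real_eigenfunction:
  fixes F F' :: "'e \<Rightarrow> real \<Rightarrow> real" and c :: "'v \<Rightarrow> real"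
  assumes F: "\<And>e x. (F e has_real_derivative F' e x) (at x)"
    and F': "\<And>e x. (F' e has_real_derivative - \<mu> * F e x) (at x)"
    and ends: "\<And>e. e \<in> arcs G \<Longrightarrow> F e 0 = c (tail G e)" "\<And>e. e \<in> arcs G \<Longrightarrow> F e (len e) = c (head G e)"
    and kirchhoff: "\<And>v. v \<in> verts G \<Longrightarrow>
      (\<Sum>e\<in>out_arcs G v. F' e 0) + (\<Sum>e\<in>in_arcs G v. - F' e (len e)) = 0"
    and nonzero: "e \<in> arcs G" "x \<in> {0..len e}" "F e x \<noteq> 0"
  shows "\<mu> \<in> eigenvalues G len"
proof -
  define f where "f e x = (if e \<in> arcs G \<and> x \<in> {0..len e} then complex_of_real (F e x) else 0)" for e x
  define f' where "f' e x = complex_of_real (F' e x)" for e x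
  have "classical_eigenfunction G len \<mu> f f'"
    unfolding classical_eigenfunction_def
  proof (intro conjI allI ballI impI)
    show "f e x = 0" if "\<not> (e \<in> arcs G \<and> x \<in> {0..len e})" for e x
      using that by (simp only: f_def if_False)
  next
    fix v assume v: "v \<in> verts G"
    show "continuous_at_vertex G len f v"
      unfolding continuous_at_vertex_def
      by (intro exI[of _ "complex_of_real (c v)"] conjI ballI)
        (auto simp: f_def ends less_imp_le[OF len_pos])
    have "(\<Sum>e\<in>out_arcs G v. f' e 0) + (\<Sum>e\<in>in_arcs G v. - f' e (len e)) =
        complex_of_real ((\<Sum>e\<in>out_arcs G v. F' e 0) + (\<Sum>e\<in>in_arcs G v. - F' e (len e)))"
      by (simp add: f'_def)
    then show "kirchhoff_at_vertex G len f' v"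
      unfolding kirchhoff_at_vertex_def using kirchhoff[OF v] by simp
  next
    fix e x assume e: "e \<in> arcs G" and x: "x \<in> {0..len e}"
    have f_eq: "f e y = complex_of_real (F e y)" if "y \<in> {0..len e}" for y
      using e that by (simp add: f_def)
    have "((\<lambda>y. complex_of_real (F e y)) has_vector_derivative complex_of_real (F' e x)) (at x within {0..len e})"
      by (intro has_vector_derivative_of_real has_field_derivative_at_within[OF F])
    then show "(f e has_vector_derivative f' e x) (at x within {0..len e})"
      unfolding f'_def by (rule has_vector_derivative_transform[OF x f_eq, rotated])
    have "((\<lambda>y. complex_of_real (F' e y)) has_vector_derivative complex_of_real (- \<mu> * F e x)) (at x within {0..len e})"
      by (intro has_vector_derivative_of_real has_field_derivative_at_within[OF F'])
    then show "(f' e has_vector_derivative - complex_of_real \<mu> * f e x) (at x within {0..len e})"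
      unfolding f'_def f_eq[OF x] by simp
  qed
  then have "f \<in> eigenspace G len \<mu>"
    using eigenspace_iff_classical by blast
  moreover have "f e x \<noteq> 0" using nonzero by (simp add: f_def)
  then have "f \<noteq> 0" by auto
  ultimately show ?thesis unfolding eigenvalues_def by blast
qed

lemma zero_eigenvalue: "0 \<in> eigenvalues G len"
proof -
  obtain e where e: "e \<in> arcs G" using arcs_nonempty by blast
  show ?thesis
    by (rule eigenvalue_of_real_eigenfunction[of "\<lambda>_ _. 1" "\<lambda>_ _. 0" 0 "\<lambda>_. 1" e 0])
      (use e len_pos[OF e] in auto)
qed

text \<open>
  The infimum that defines the eigenvalue is over a set bounded below by \<open>0\<close>, since eigenvalues are
  nonnegative; \<open>k\<^sup>2\<close> belongs to it because of the two eigenvalues \<open>0\<close> and \<open>k\<^sup>2\<close>.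
\<close>

lemma second_eigenvalue_le:
  assumes k: "0 < k" and ev: "k\<^sup>2 \<in> eigenvalues G len"
  shows "kth_eigenvalue G len 2 \<le> k\<^sup>2"
proof -
  define T where "T = {t. \<exists>S. finite S \<and> S \<subseteq> eigenvalues G len \<inter> {..t} \<and>
             2 \<le> (\<Sum>\<mu>\<in>S. multiplicity G len \<mu>)}"
  have "(0::real)\<^sup>2 \<in> eigenvalues G len" using zero_eigenvalue by simp
  from multiplicity_pos[OF this] have "1 \<le> multiplicity G len 0" by simp
  moreover have "(\<Sum>\<mu>\<in>{0, k\<^sup>2}. multiplicity G len \<mu>) = multiplicity G len 0 + multiplicity G len (k\<^sup>2)"
    using k by simp
  ultimately have "2 \<le> (\<Sum>\<mu>\<in>{0, k\<^sup>2}. multiplicity G len \<mu>)"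
    using multiplicity_pos[OF ev] by linarith
  then have "k\<^sup>2 \<in> T"
    unfolding T_def using zero_eigenvalue ev by (intro CollectI exI[of _ "{0, k\<^sup>2}"]) auto
  moreover have "bdd_below T"
  proof (rule bdd_belowI)
    fix t assume "t \<in> T"
    then obtain S where S: "S \<subseteq> eigenvalues G len \<inter> {..t}" "2 \<le> (\<Sum>\<mu>\<in>S. multiplicity G len \<mu>)"
      unfolding T_def by blast
    then have "S \<noteq> {}" by auto
    then obtain \<mu> where "\<mu> \<in> S" by blast
    with S(1) have "\<mu> \<in> eigenvalues G len" "\<mu> \<le> t" by auto
    then show "0 \<le> t" using eigenvalue_nonneg by force
  qed
  ultimately show ?thesis
    unfolding kth_eigenvalue_def T_def by (rule cInf_lower)
qed

end

section \<open>Paths and distances\<close>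

lemma is_path_append:
  "is_path G len p w q \<Longrightarrow> is_path G len q w' r \<Longrightarrow> is_path G len p (w @ w') r"
  by (induction G len p w q rule: is_path.induct) auto

lemma path_length_append: "path_length (w @ w') = path_length w + path_length w'"
  by (simp add: path_length_def)

lemma path_length_nonneg: "0 \<le> path_length w"
  unfolding path_length_def by (intro sum_list_nonneg) auto

lemma mg_dist_le_path_length:
  assumes "is_path G len p w q"
  shows "mg_dist G len p q \<le> path_length w"
proof -
  have "bdd_below {path_length w | w. is_path G len p w q}"
    using path_length_nonneg by (intro bdd_belowI[of _ 0]) auto
  then show ?thesis unfolding mg_dist_def using assms by (intro cInf_lower) auto
qed

lemma le_mg_dist:
  assumes "is_path G len p w0 q" and "\<And>w. is_path G len p w q \<Longrightarrow> c \<le> path_length w"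
  shows "c \<le> mg_dist G len p q"
  unfolding mg_dist_def using assms by (intro cInf_greatest) auto

lemma lipschitz_along_path:
  assumes g: "\<And>e s t. e \<in> arcs G \<Longrightarrow> s \<in> {0..len e} \<Longrightarrow> t \<in> {0..len e} \<Longrightarrow>
      g (edge_point G len e t) - g (edge_point G len e s) \<le> \<bar>t - s\<bar>"
    and "is_path G len p w q"
  shows "g q - g p \<le> path_length w"
  using assms(2)
proof (induction w arbitrary: p)
  case Nil
  then show ?case by (simp add: path_length_def)
next
  case (Cons a w)
  obtain e s t where a: "a = (e, s, t)" by (cases a)
  have *: "e \<in> arcs G" "s \<in> {0..len e}" "t \<in> {0..len e}" "p = edge_point G len e s"
      "is_path G len (edge_point G len e t) w q"
    using Cons.prems unfolding a by auto
  have "g q - g (edge_point G len e t) \<le> path_length w" by (rule Cons.IH[OF *(5)])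
  moreover have "g (edge_point G len e t) - g p \<le> \<bar>t - s\<bar>"
    unfolding *(4) by (rule g[OF *(1-3)])
  ultimately show ?case unfolding a by (simp add: path_length_def)
qed

context metric_graph
begin

lemma edge_point_0 [simp]: "edge_point G len e 0 = Vertex (tail G e)"
  by (simp add: edge_point_def)

lemma edge_point_len: "e \<in> arcs G \<Longrightarrow> edge_point G len e (len e) = Vertex (head G e)"
  using len_pos[of e] by (simp add: edge_point_def)

lemma edge_point_in_points:
  assumes "e \<in> arcs G" "t \<in> {0..len e}"
  shows "edge_point G len e t \<in> points G len"
  using assms by (auto simp: edge_point_def points_def less_le)

lemma len_le_total: "e \<in> arcs G \<Longrightarrow> len e \<le> total_length G len"
  unfolding total_length_def using len_pos by (intro member_le_sum) (auto simp: less_imp_le)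

lemma total_length_pos: "0 < total_length G len"
  unfolding total_length_def using len_pos arcs_nonempty by (intro sum_pos) auto

end

locale connected_metric_graph = metric_graph +
  assumes conn: "Digraph_Component.connected G"
begin

lemma constant_on_verts:
  assumes P: "\<And>e. e \<in> arcs G \<Longrightarrow> P (tail G e) = P (head G e)"
    and u: "u \<in> verts G" and v: "v \<in> verts G" and "P u"
  shows "P v"
proof -
  interpret S: pair_wf_digraph "mk_symmetric G" ..
  have "u \<rightarrow>\<^sup>*\<^bsub>with_proj (mk_symmetric G)\<^esub> v"
    using conn u v unfolding Digraph_Component.connected_def strongly_connected_def by simp
  then show ?thesis
  proof (induction rule: S.reachable_induct)
    case base
    show ?case by fact
  next
    case (step x y)
    then have "(x, y) \<in> parcs (mk_symmetric G)" by simp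
    then show ?case using P step.IH by (auto simp: parcs_mk_symmetric)
  qed
qed

lemma point_on_edge:
  assumes "p \<in> points G len"
  obtains e t where "e \<in> arcs G" "t \<in> {0..len e}" "p = edge_point G len e t"
proof (cases p)
  case (Vertex v)
  then have v: "v \<in> verts G" using assms by (auto simp: points_def)
  obtain e0 where e0: "e0 \<in> arcs G" using arcs_nonempty by blast
  \<comment> \<open>No vertex is isolated, as being an end of an arc is passed on along arcs.\<close>
  define P where "P x \<longleftrightarrow> (\<exists>e\<in>arcs G. x = tail G e \<or> x = head G e)" for x
  have "P v"
    by (rule constant_on_verts[of P "tail G e0"]) (use e0 v in \<open>auto simp: P_def\<close>)
  then obtain e where e: "e \<in> arcs G" "v = tail G e \<or> v = head G e" unfolding P_def by blast
  from e(2) show thesis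
  proof
    assume "v = tail G e"
    then show thesis using that[of e 0] e(1) len_pos[OF e(1)] Vertex by simp
  next
    assume "v = head G e"
    then show thesis using that[of e "len e"] e(1) len_pos[OF e(1)] Vertex by (simp add: edge_point_len)
  qed
next
  case (Interior e t)
  then have "e \<in> arcs G" "0 < t" "t < len e" using assms by (auto simp: points_def)
  then show thesis using that[of e t] Interior by (simp add: edge_point_def)
qed

lemma path_exists:
  assumes "p \<in> points G len" and "q \<in> points G len"
  obtains w where "is_path G len p w q"
proof -
  obtain e0 s0 where p: "e0 \<in> arcs G" "s0 \<in> {0..len e0}" "p = edge_point G len e0 s0"
    using assms(1) by (rule point_on_edge)
  obtain e1 t1 where q: "e1 \<in> arcs G" "t1 \<in> {0..len e1}" "q = edge_point G len e1 t1"
    using assms(2) by (rule point_on_edge)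
  define P where "P v \<longleftrightarrow> (\<exists>w. is_path G len p w (Vertex v))" for v
  have P_edge: "P (tail G e) = P (head G e)" if e: "e \<in> arcs G" for e
  proof -
    have "is_path G len (Vertex (tail G e)) [(e, 0, len e)] (Vertex (head G e))"
      "is_path G len (Vertex (head G e)) [(e, len e, 0)] (Vertex (tail G e))"
      using e len_pos[OF e] by (simp_all add: edge_point_len)
    then show ?thesis unfolding P_def by (meson is_path_append)
  qed
  have "is_path G len p [(e0, s0, 0)] (Vertex (tail G e0))" using p by simp
  then have "P (tail G e0)" unfolding P_def by blast
  then have "P (tail G e1)"
    by (rule constant_on_verts[of P "tail G e0", OF P_edge, rotated -1]) (use p(1) q(1) in auto)
  then obtain w where "is_path G len p w (Vertex (tail G e1))" unfolding P_def by blast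
  moreover have "is_path G len (Vertex (tail G e1)) [(e1, 0, t1)] q"
    using q by simp
  ultimately show thesis using that is_path_append by blast
qed

lemma mg_dist_self: "mg_dist G len p p \<le> 0"
  using mg_dist_le_path_length[of G len p "[]" p] by (simp add: path_length_def)

lemma mg_dist_lipschitz:
  assumes p: "p \<in> points G len" and e: "e \<in> arcs G" and s: "s \<in> {0..len e}" and t: "t \<in> {0..len e}"
  shows "mg_dist G len p (edge_point G len e t) - mg_dist G len p (edge_point G len e s) \<le> \<bar>t - s\<bar>"
proof -
  obtain w0 where w0: "is_path G len p w0 (edge_point G len e s)"
    using path_exists[OF p edge_point_in_points[OF e s]] .
  have "mg_dist G len p (edge_point G len e t) - \<bar>t - s\<bar> \<le> mg_dist G len p (edge_point G len e s)"
  proof (rule le_mg_dist[OF w0])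
    fix w assume "is_path G len p w (edge_point G len e s)"
    then have "is_path G len p (w @ [(e, s, t)]) (edge_point G len e t)"
      by (rule is_path_append) (use e s t in simp)
    from mg_dist_le_path_length[OF this]
    show "mg_dist G len p (edge_point G len e t) - \<bar>t - s\<bar> \<le> path_length w"
      by (simp add: path_length_append) (simp add: path_length_def)
  qed
  then show ?thesis by simp
qed

end

section \<open>Subdivision of the edges\<close>

context connected_metric_graph
begin

definition grid :: "nat \<Rightarrow> 'b \<Rightarrow> nat \<Rightarrow> ('a, 'b) mg_point" where
  "grid N e i = edge_point G len e (real i * (len e / real N))"

definition segments :: "nat \<Rightarrow> ('b \<times> nat) set" where
  "segments N = arcs G \<times> {..<N}"

lemma grid_coordinate:
  assumes "e \<in> arcs G" "0 < N" "i \<le> N"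
  shows "real i * (len e / real N) \<in> {0..len e}"
proof -
  have "real i * len e \<le> real N * len e"
    using assms len_pos[OF assms(1)] by (intro mult_right_mono) auto
  then show ?thesis using assms len_pos[OF assms(1)] by (simp add: field_simps)
qed

lemma grid_ends:
  assumes "e \<in> arcs G" "0 < N"
  shows "grid N e 0 = Vertex (tail G e)" "grid N e N = Vertex (head G e)"
  using assms by (simp_all add: grid_def edge_point_len)

lemma grid_interior:
  assumes "e \<in> arcs G" "0 < i" "i < N"
  shows "grid N e i = Interior e (real i * (len e / real N))"
  using assms len_pos[OF assms(1)] by (simp add: grid_def edge_point_def field_simps)

lemma grid_eq_interior_iff:
  assumes e: "e \<in> arcs G" and i: "0 < i" "i < N" and e': "e' \<in> arcs G" and j: "j \<le> N"
  shows "grid N e' j = grid N e i \<longleftrightarrow> e' = e \<and> j = i"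
proof -
  consider "j = 0" | "j = N" | "0 < j" "j < N" using j by linarith
  then show ?thesis
  proof cases
    case 1
    then show ?thesis using grid_ends[OF e', of N] grid_interior[OF e i] i by auto
  next
    case 2
    then show ?thesis using grid_ends[OF e', of N] grid_interior[OF e i] i by auto
  next
    case 3
    then show ?thesis
      using grid_interior[OF e' 3] grid_interior[OF e i] i len_pos[OF e] by auto
  qed
qed

lemma grid_eq_Vertex_iff:
  assumes e: "e \<in> arcs G" and i: "i < N"
  shows "grid N e i = Vertex v \<longleftrightarrow> i = 0 \<and> tail G e = v"
    and "grid N e (Suc i) = Vertex v \<longleftrightarrow> Suc i = N \<and> head G e = v"
proof -
  show "grid N e i = Vertex v \<longleftrightarrow> i = 0 \<and> tail G e = v"
    using grid_ends[OF e, of N] grid_interior[OF e, of i N] i by (cases "i = 0") auto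
  show "grid N e (Suc i) = Vertex v \<longleftrightarrow> Suc i = N \<and> head G e = v"
    using grid_ends[OF e, of N] grid_interior[OF e, of "Suc i" N] i by (cases "Suc i = N") auto
qed

lemma grid_points:
  assumes "0 < N"
  shows "(\<lambda>(e, i). grid N e i) ` segments N \<union> (\<lambda>(e, i). grid N e (Suc i)) ` segments N =
    {grid N e i | e i. e \<in> arcs G \<and> i \<le> N}"
  (is "?A \<union> ?B = ?R")
proof (intro equalityI subsetI)
  fix x assume "x \<in> ?A \<union> ?B"
  then obtain e i where "e \<in> arcs G" "i < N" "x = grid N e i \<or> x = grid N e (Suc i)"
    by (auto simp: segments_def)
  then have "e \<in> arcs G \<and> i \<le> N \<and> x = grid N e i \<or> e \<in> arcs G \<and> Suc i \<le> N \<and> x = grid N e (Suc i)"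
    by auto
  then show "x \<in> ?R" by blast
next
  fix x assume "x \<in> ?R"
  then obtain e i where e: "e \<in> arcs G" and i: "i \<le> N" and x: "x = grid N e i" by blast
  show "x \<in> ?A \<union> ?B"
  proof (cases "i < N")
    case True
    then show ?thesis using e x by (intro UnI1 image_eqI[of _ _ "(e, i)"]) (simp_all add: segments_def)
  next
    case False
    then have "i = Suc (N - 1)" using assms i by simp
    then show ?thesis
      using e x assms by (intro UnI2 image_eqI[of _ _ "(e, N - 1)"]) (simp_all add: segments_def)
  qed
qed

text \<open>
  Along an edge a property that is passed on at each step carries over from one end to the other;
  between vertices connectedness of the graph applies.
\<close>

lemma network_of_grid:
  assumes N: "0 < N"
  shows "finite_network (segments N) (\<lambda>(e, i). grid N e i) (\<lambda>(e, i). grid N e (Suc i))"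
proof
  show "finite (segments N)" by (simp add: segments_def)
  show "segments N \<noteq> {}" using arcs_nonempty N by (auto simp: segments_def)
  fix P :: "('a, 'b) mg_point \<Rightarrow> bool" and x y
  assume P: "\<And>s. s \<in> segments N \<Longrightarrow> P (case s of (e, i) \<Rightarrow> grid N e i) = P (case s of (e, i) \<Rightarrow> grid N e (Suc i))"
    and x: "x \<in> (\<lambda>(e, i). grid N e i) ` segments N \<union> (\<lambda>(e, i). grid N e (Suc i)) ` segments N"
    and y: "y \<in> (\<lambda>(e, i). grid N e i) ` segments N \<union> (\<lambda>(e, i). grid N e (Suc i)) ` segments N"
    and "P x"
  have along: "P (grid N e i) = P (Vertex (tail G e))" if e: "e \<in> arcs G" and "i \<le> N" for e i
    using \<open>i \<le> N\<close>
  proof (induction i)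
    case 0
    then show ?case using grid_ends[OF e N] by simp
  next
    case (Suc i)
    then show ?case using P[of "(e, i)"] e by (simp add: segments_def)
  qed
  obtain e i where xe: "e \<in> arcs G" "i \<le> N" "x = grid N e i"
    using x unfolding grid_points[OF N] by blast
  obtain e' j where ye: "e' \<in> arcs G" "j \<le> N" "y = grid N e' j"
    using y unfolding grid_points[OF N] by blast
  have "P (Vertex (tail G e))" using along[OF xe(1,2)] xe(3) \<open>P x\<close> by simp
  moreover have "P (Vertex (tail G e)) = P (Vertex (head G e))" if "e \<in> arcs G" for e
    using along[OF that order.refl] grid_ends[OF that N] by simp
  ultimately have "P (Vertex (tail G e'))"
    using constant_on_verts[of "\<lambda>v. P (Vertex v)" "tail G e" "tail G e'"] xe(1) ye(1) by simp
  then show "P y" using along[OF ye(1,2)] ye(3) by simp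
qed

lemma sum_segments:
  assumes "0 < N"
  shows "(\<Sum>(e, i)\<in>segments N. len e / real N) = total_length G len"
proof -
  have "(\<Sum>(e, i)\<in>segments N. len e / real N) = (\<Sum>e\<in>arcs G. \<Sum>i<N. len e / real N)"
    unfolding segments_def by (rule sum.cartesian_product[symmetric])
  then show ?thesis using assms by (simp add: total_length_def)
qed

lemma grid_step_lipschitz:
  assumes p: "p \<in> points G len" and e: "e \<in> arcs G" and i: "i < N"
  shows "\<bar>mg_dist G len p (grid N e i) - mg_dist G len p (grid N e (Suc i))\<bar> \<le> len e / real N"
proof -
  define s t where "s = real i * (len e / real N)" and "t = real (Suc i) * (len e / real N)"
  have st: "s \<in> {0..len e}" "t \<in> {0..len e}"
    unfolding s_def t_def using i by (intro grid_coordinate e; simp)+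
  have "\<bar>t - s\<bar> = len e / real N" "\<bar>s - t\<bar> = len e / real N"
    using len_pos[OF e] i by (simp_all add: s_def t_def field_simps)
  then show ?thesis
    using mg_dist_lipschitz[OF p e st] mg_dist_lipschitz[OF p e st(2,1)]
    by (simp add: grid_def s_def t_def abs_le_iff)
qed

text \<open>
  A crude bound, needed because an unbounded supremum of reals has no meaning. Between vertices the
  distance from \<open>p\<close> varies by at most \<open>L\<close>, its total variation on the uncut graph (\<open>N = 1\<close>); getting
  from the vertices to \<open>p\<close> and to \<open>q\<close> costs at most the length of an edge each.
\<close>

lemma mg_dist_bounded:
  assumes p: "p \<in> points G len" and q: "q \<in> points G len"
  shows "mg_dist G len p q \<le> 3 * total_length G len"
proof -
  obtain e0 s0 where pe: "e0 \<in> arcs G" "s0 \<in> {0..len e0}" "p = edge_point G len e0 s0"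
    using p by (rule point_on_edge)
  obtain e1 t1 where qe: "e1 \<in> arcs G" "t1 \<in> {0..len e1}" "q = edge_point G len e1 t1"
    using q by (rule point_on_edge)
  define d where "d = mg_dist G len p"
  interpret net: finite_network "segments 1" "\<lambda>(e, i). grid 1 e i" "\<lambda>(e, i). grid 1 e (Suc i)"
    by (rule network_of_grid) simp
  have X: "Vertex (tail G e) \<in> net.nodes" if "e \<in> arcs G" for e
  proof -
    have "grid 1 e 0 = Vertex (tail G e)" using grid_ends(1)[OF that, of 1] by simp
    then show ?thesis
      unfolding net.nodes_def grid_points[OF zero_less_one] using that by (metis (mono_tags, lifting) le0 mem_Collect_eq)
  qed
  have "d (Vertex (tail G e1)) - d (Vertex (tail G e0)) \<le>
      (\<Sum>s\<in>segments 1. \<bar>d (case s of (e, i) \<Rightarrow> grid 1 e i) - d (case s of (e, i) \<Rightarrow> grid 1 e (Suc i))\<bar>)"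
    by (rule net.range_le_total_variation[OF X[OF pe(1)] X[OF qe(1)]])
  also have "\<dots> \<le> (\<Sum>(e, i)\<in>segments 1. len e / real 1)"
    unfolding d_def by (rule sum_mono) (use grid_step_lipschitz[OF p, of _ _ 1] in \<open>auto simp: segments_def\<close>)
  also have "\<dots> = total_length G len" by (rule sum_segments) simp
  finally have "d (Vertex (tail G e1)) - d (Vertex (tail G e0)) \<le> total_length G len" .
  moreover have "d q - d (Vertex (tail G e1)) \<le> total_length G len"
    using mg_dist_lipschitz[OF p qe(1) _ qe(2), of 0] qe len_le_total[OF qe(1)] len_pos[OF qe(1)]
    by (simp add: d_def)
  moreover have "d (Vertex (tail G e0)) - d p \<le> total_length G len"
    using mg_dist_lipschitz[OF p pe(1) pe(2), of 0] pe len_le_total[OF pe(1)] len_pos[OF pe(1)]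
    by (simp add: d_def)
  moreover have "d p \<le> 0" unfolding d_def by (rule mg_dist_self)
  ultimately show ?thesis unfolding d_def by linarith
qed

lemma bdd_above_mg_dist:
  "bdd_above ((\<lambda>(p, q). mg_dist G len p q) ` (points G len \<times> points G len))"
  using mg_dist_bounded by (intro bdd_aboveI[of _ "3 * total_length G len"]) auto

text \<open>
  The tent function on one edge, extended by zero, is Lipschitz along paths. So every path from
  an end of the edge to its midpoint has at least half the length of the edge.
\<close>

lemma mg_diameter_pos: "0 < mg_diameter G len"
proof -
  obtain e where e: "e \<in> arcs G" using arcs_nonempty by blast
  define l where "l = len e"
  have l: "0 < l" using len_pos[OF e] by (simp add: l_def)
  define g where "g p = (case p of Vertex v \<Rightarrow> 0 | Interior e' x \<Rightarrow> if e' = e then min x (l - x) else 0)"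
    for p :: "('a, 'b) mg_point"
  have g_edge: "g (edge_point G len e' x) = (if e' = e then min x (l - x) else 0)"
    if "x \<in> {0..len e'}" for e' x
    using that l by (auto simp: g_def edge_point_def l_def)
  have g_lip: "g (edge_point G len e' t) - g (edge_point G len e' s) \<le> \<bar>t - s\<bar>"
    if "s \<in> {0..len e'}" "t \<in> {0..len e'}" for e' s t
    unfolding g_edge[OF that(1)] g_edge[OF that(2)] by (auto simp: min_def)
  define p :: "('a, 'b) mg_point" where "p = Vertex (tail G e)"
  define q where "q = edge_point G len e (l / 2)"
  have pq: "p \<in> points G len" "q \<in> points G len"
    using edge_point_in_points[OF e, of 0] edge_point_in_points[OF e, of "l / 2"] l
    by (simp_all add: p_def q_def l_def)
  have gpq: "g q - g p = l / 2"
    using g_edge[of "l / 2" e] l by (simp add: p_def q_def l_def g_def)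
  obtain w0 where "is_path G len p w0 q" using path_exists[OF pq] .
  then have "l / 2 \<le> mg_dist G len p q"
    by (rule le_mg_dist) (use lipschitz_along_path[of G len g, OF g_lip] gpq in force)
  also have "\<dots> \<le> mg_diameter G len"
    unfolding mg_diameter_def
    using cSUP_upper[OF _ bdd_above_mg_dist, of "(p, q)"] pq by simp
  finally show ?thesis using l by linarith
qed

lemma nearly_diametral_points:
  assumes "c < mg_diameter G len"
  obtains p q where "p \<in> points G len" "q \<in> points G len" "c < mg_dist G len p q"
proof -
  obtain e where e: "e \<in> arcs G" using arcs_nonempty by blast
  have "edge_point G len e 0 \<in> points G len"
    using edge_point_in_points[OF e, of 0] len_pos[OF e] by simp
  then have "points G len \<times> points G len \<noteq> {}" by blast
  from less_cSUP_iff[OF this bdd_above_mg_dist, of c] assms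
  show ?thesis using that unfolding mg_diameter_def by auto
qed

lemma near_grid_point:
  assumes N: "0 < N" and p: "p \<in> points G len" and q: "q \<in> points G len"
  obtains e i where "e \<in> arcs G" "i \<le> N"
    "\<bar>mg_dist G len p (grid N e i) - mg_dist G len p q\<bar> \<le> total_length G len / real N"
proof -
  obtain e t where qe: "e \<in> arcs G" "t \<in> {0..len e}" "q = edge_point G len e t"
    using q by (rule point_on_edge)
  define h where "h = len e / real N"
  have h: "0 < h" using len_pos[OF qe(1)] N by (simp add: h_def)
  define i where "i = nat \<lfloor>t / h\<rfloor>"
  have "0 \<le> t / h" using qe(2) h by simp
  then have i: "real i \<le> t / h" "t / h < real i + 1"
    unfolding i_def by linarith+
  have "t / h \<le> real N" using qe(2) h N by (simp add: h_def field_simps)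
  then have iN: "i \<le> N" using i by linarith
  have "real i * h \<le> t" "t < real i * h + h"
    using i h by (simp_all add: field_simps)
  then have "\<bar>t - real i * h\<bar> \<le> h" "\<bar>real i * h - t\<bar> \<le> h" by linarith+
  moreover have "h \<le> total_length G len / real N"
    unfolding h_def using len_le_total[OF qe(1)] N by (intro divide_right_mono) auto
  moreover have "real i * h \<in> {0..len e}"
    unfolding h_def by (rule grid_coordinate[OF qe(1) N iN])
  ultimately have "\<bar>mg_dist G len p (grid N e i) - mg_dist G len p q\<bar> \<le> total_length G len / real N"
    using mg_dist_lipschitz[OF p qe(1) _ qe(2), of "real i * h"] mg_dist_lipschitz[OF p qe(1) qe(2), of "real i * h"]
    unfolding grid_def qe(3) h_def[symmetric] by linarith
  then show thesis using that qe(1) iN by blast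
qed

end

section \<open>Segment weights\<close>

lemma edge_trig_add:
  "edge_cos k (x + h) = edge_cos k x * edge_cos k h - k\<^sup>2 * edge_sin k x * edge_sin k h"
  "edge_sin k (x + h) = edge_sin k x * edge_cos k h + edge_cos k x * edge_sin k h"
  by (cases "k = 0"; simp add: edge_cos_def edge_sin_def distrib_left cos_add sin_add power2_eq_square add_divide_distrib)+

text \<open>
  These are \<open>k/sin(kh)\<close> and \<open>tan(kh/2)/k\<close>, written with \<open>sinc\<close> to be continuous at \<open>k = 0\<close>, where
  they become \<open>1/h\<close> and \<open>h/2\<close>.
\<close>

definition stiffness :: "real \<Rightarrow> real \<Rightarrow> real" where
  "stiffness h k = 1 / (h * sinc (k * h))"

definition inertia :: "real \<Rightarrow> real \<Rightarrow> real" where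
  "inertia h k = h / 2 * sinc (k * h / 2) / cos (k * h / 2)"

text \<open>
  The quotient on the right is \<open>u'(0)\<close> for the solution of \<open>-u'' = k\<^sup>2u\<close> with \<open>u(0) = x\<close> and \<open>u(h) = y\<close>.
\<close>

lemma stiffness_inertia_slope:
  assumes k: "0 < k" and h: "0 < h" and kh: "k * h < pi"
  shows "stiffness h k * (x - y) - k\<^sup>2 * inertia h k * x = - ((y - x * edge_cos k h) / edge_sin k h)"
proof -
  define c s where "c = cos (k * h / 2)" and "s = sin (k * h / 2)"
  have "0 < k * h" using k h by simp
  have c: "0 < c" unfolding c_def by (rule cos_gt_zero) (use \<open>0 < k * h\<close> kh in linarith)+
  have s: "0 < s" unfolding s_def by (rule sin_gt_zero) (use \<open>0 < k * h\<close> kh in linarith)+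
  have s2: "sin (k * h) = 2 * s * c"
    using sin_double[of "k * h / 2"] by (simp add: c_def s_def)
  have c2: "cos (k * h) = 1 - 2 * s\<^sup>2"
    using cos_double_sin[of "k * h / 2"] by (simp add: s_def)
  have 1: "stiffness h k = k / (2 * s * c)"
    using k h by (simp add: stiffness_def s2)
  have 2: "k\<^sup>2 * inertia h k = k * s / c"
    using k h by (simp add: inertia_def s_def[symmetric] c_def[symmetric] power2_eq_square)
  have 3: "edge_sin k h = 2 * s * c / k" "edge_cos k h = 1 - 2 * s\<^sup>2"
    using k by (simp_all add: edge_sin_def edge_cos_def s2 c2)
  show ?thesis
    unfolding 1 2 3 using k s c by (simp add: field_simps power2_eq_square)
qed

lemma cos_ge_quadratic: "1 - x\<^sup>2 / 2 \<le> cos (x :: real)"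
proof -
  have "(sin (x / 2))\<^sup>2 \<le> (x / 2)\<^sup>2"
    by (metis abs_le_square_iff abs_sin_x_le_abs_x)
  then show ?thesis using cos_double_sin[of "x / 2"] by (simp add: power_divide)
qed

lemma cos_le_sinc:
  assumes "0 \<le> x" "x \<le> pi"
  shows "cos x \<le> sinc x"
proof (cases "x = 0")
  case False
  then have x: "0 < x" using assms by simp
  obtain z where z: "0 < z" "z < x" "sin x - sin 0 = (x - 0) * cos z"
    using MVT2[OF x, of sin cos] DERIV_sin by blast
  have "cos x \<le> cos z" by (rule cos_monotone_0_pi_le) (use z assms in auto)
  then show ?thesis using z x by simp
qed simp

lemma sinc_bounds:
  assumes "0 \<le> x" "x \<le> 1 / 2"
  shows "5 / 6 \<le> cos x" "5 / 6 \<le> sinc x" "cos x \<le> sinc x"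
proof -
  have "x\<^sup>2 \<le> (1 / 2)\<^sup>2" using assms by (intro power_mono) auto
  then show 1: "5 / 6 \<le> cos x" using cos_ge_quadratic[of x] by (simp add: power2_eq_square)
  show 2: "cos x \<le> sinc x" by (rule cos_le_sinc) (use assms pi_gt3 in auto)
  show "5 / 6 \<le> sinc x" using 1 2 by linarith
qed

text \<open>
  Compared with the weights \<open>1/h\<close> and \<open>h/2\<close> of linear interpolation and the trapezoidal rule,
  only the factor \<open>6/5\<close> is lost.
\<close>

lemma weight_bounds:
  assumes h: "0 < h" and k: "0 \<le> k" and kh: "k * h \<le> 1 / 2"
  shows "0 < stiffness h k" "stiffness h k \<le> 6 / 5 / h" "h / 2 \<le> inertia h k"
proof -
  have kh0: "0 \<le> k * h" using h k by simp
  note b = sinc_bounds[OF kh0 kh]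
  have b2: "5 / 6 \<le> cos (k * h / 2)" "cos (k * h / 2) \<le> sinc (k * h / 2)"
    by (rule sinc_bounds; use kh0 kh in linarith)+
  have sp: "0 < sinc (k * h)" using b(2) by linarith
  show "0 < stiffness h k" unfolding stiffness_def using mult_pos_pos[OF h sp] by (simp only: zero_less_divide_1_iff)
  have "5 / 6 * h \<le> h * sinc (k * h)" using mult_left_mono[OF b(2), of h] h by linarith
  then have "1 / (h * sinc (k * h)) \<le> 1 / (5 / 6 * h)"
    using h by (intro divide_left_mono mult_pos_pos sp) auto
  also have "\<dots> = 6 / 5 / h" using h by (simp add: field_simps)
  finally show "stiffness h k \<le> 6 / 5 / h" unfolding stiffness_def .
  have "1 \<le> sinc (k * h / 2) / cos (k * h / 2)"
    using b2 by (subst le_divide_eq_1_pos) linarith+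
  then have "h / 2 * 1 \<le> h / 2 * (sinc (k * h / 2) / cos (k * h / 2))"
    using h by (intro mult_left_mono) auto
  then show "h / 2 \<le> inertia h k" unfolding inertia_def by simp
qed

lemma weight_continuous:
  assumes h: "0 < h" and Kh: "K * h \<le> 1 / 2"
  shows "continuous_on {0..K} (stiffness h)" "continuous_on {0..K} (inertia h)"
proof -
  have kh: "0 \<le> k * h" "k * h \<le> 1 / 2" if "k \<in> {0..K}" for k
  proof -
    show "0 \<le> k * h" using that h by simp
    have "k * h \<le> K * h" using that h by (intro mult_right_mono) auto
    with Kh show "k * h \<le> 1 / 2" by linarith
  qed
  have nz: "h * sinc (k * h) \<noteq> 0" if "k \<in> {0..K}" for k
    using sinc_bounds(2)[OF kh[OF that]] h by (metis divide_le_0_iff less_irrefl mult_eq_0_iff not_le zero_less_numeral)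
  show "continuous_on {0..K} (stiffness h)"
    unfolding stiffness_def[abs_def]
    by (intro continuous_on_divide continuous_on_mult continuous_on_sinc continuous_on_const
        continuous_on_id ballI) (erule nz)
  have "cos (k * h / 2) \<noteq> 0" if "k \<in> {0..K}" for k
    using sinc_bounds(1)[of "k * h / 2"] kh[OF that] by auto
  then show "continuous_on {0..K} (inertia h)"
    unfolding inertia_def[abs_def] by (intro continuous_intros) auto
qed

text \<open>
  Since \<open>u\<^sup>3/3\<close> is the antiderivative of \<open>u\<^sup>2\<close>, the first bound is the trapezoidal rule for a convex
  function, and the second one is the variance \<open>F\<^sup>3/12\<close> of an interval of length \<open>F\<close>.
\<close>

lemma cube_difference_bounds:
  fixes u v h :: real
  shows "\<bar>u - v\<bar> \<le> h \<Longrightarrow> \<bar>u ^ 3 / 3 - v ^ 3 / 3\<bar> \<le> h / 2 * (u\<^sup>2 + v\<^sup>2)"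
    and "v \<le> u \<Longrightarrow> (u - v) ^ 3 / 12 \<le> u ^ 3 / 3 - v ^ 3 / 3"
proof -
  have fac: "u ^ 3 / 3 - v ^ 3 / 3 = (u - v) * ((u\<^sup>2 + u * v + v\<^sup>2) / 3)"
    by (simp add: algebra_simps power2_eq_square power3_eq_cube)
  have uv: "2 * (u * v) \<le> u\<^sup>2 + v\<^sup>2" "- 2 * (u * v) \<le> u\<^sup>2 + v\<^sup>2"
    using sum_squares_ge_zero[of "u - v" 0] sum_squares_ge_zero[of "u + v" 0]
    by (simp_all add: algebra_simps power2_eq_square)
  show "\<bar>u ^ 3 / 3 - v ^ 3 / 3\<bar> \<le> h / 2 * (u\<^sup>2 + v\<^sup>2)" if "\<bar>u - v\<bar> \<le> h"
  proof -
    have "\<bar>u ^ 3 / 3 - v ^ 3 / 3\<bar> = \<bar>u - v\<bar> * ((u\<^sup>2 + u * v + v\<^sup>2) / 3)"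
      unfolding fac abs_mult using uv by simp
    also have "\<dots> \<le> h * ((u\<^sup>2 + v\<^sup>2) / 2)"
      by (rule mult_mono[OF that]) (use that uv in auto)
    finally show ?thesis by simp
  qed
  show "(u - v) ^ 3 / 12 \<le> u ^ 3 / 3 - v ^ 3 / 3" if "v \<le> u"
  proof -
    have "(u - v) * ((u - v)\<^sup>2 / 12) \<le> (u - v) * ((u\<^sup>2 + u * v + v\<^sup>2) / 3)"
    proof (rule mult_left_mono)
      have "(u\<^sup>2 + u * v + v\<^sup>2) / 3 - (u - v)\<^sup>2 / 12 = (u + v)\<^sup>2 / 4"
        by (simp add: power2_eq_square field_simps)
      then show "(u - v)\<^sup>2 / 12 \<le> (u\<^sup>2 + u * v + v\<^sup>2) / 3"
        using zero_le_power2[of "u + v"] by linarith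
    qed (use that in simp)
    then show ?thesis unfolding fac by (simp add: power2_eq_square power3_eq_cube)
  qed
qed

section \<open>From nodal functions to eigenfunctions\<close>

context connected_metric_graph
begin

text \<open>
  On the segment \<open>(e, i)\<close> let \<open>u\<close> be the solution of \<open>-u'' = k\<^sup>2u\<close> that interpolates \<open>\<phi>\<close>; \<open>l e i\<close> and
  \<open>r e i\<close> are its derivatives at the left and right end. Balance at an interior grid point says that
  the derivatives on both sides agree, so that the pieces form a single solution \<open>F e\<close> on the whole
  edge. Balance at a vertex is Kirchhoff's condition.
\<close>

lemma eigenvalue_of_grid_function:
  fixes \<phi> :: "('a, 'b) mg_point \<Rightarrow> real"
  assumes N: "0 < N" and k: "0 < k" and kh: "\<And>e. e \<in> arcs G \<Longrightarrow> k * (len e / real N) < pi"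
    and net: "\<And>e i. e \<in> arcs G \<Longrightarrow> i \<le> N \<Longrightarrow>
      (\<Sum>(e', j) | (e', j) \<in> segments N \<and> grid N e' j = grid N e i.
        stiffness (len e' / real N) k * (\<phi> (grid N e' j) - \<phi> (grid N e' (Suc j)))
          - k\<^sup>2 * inertia (len e' / real N) k * \<phi> (grid N e' j)) +
      (\<Sum>(e', j) | (e', j) \<in> segments N \<and> grid N e' (Suc j) = grid N e i.
        stiffness (len e' / real N) k * (\<phi> (grid N e' (Suc j)) - \<phi> (grid N e' j))
          - k\<^sup>2 * inertia (len e' / real N) k * \<phi> (grid N e' (Suc j))) = 0"
    and nz: "e0 \<in> arcs G" "i0 \<le> N" "\<phi> (grid N e0 i0) \<noteq> 0"
  shows "k\<^sup>2 \<in> eigenvalues G len"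
proof -
  define h where "h e = len e / real N" for e
  have h: "0 < h e" "k * h e < pi" if "e \<in> arcs G" for e
    using len_pos[OF that] kh[OF that] N by (auto simp: h_def)
  define l where "l e i = (\<phi> (grid N e (Suc i)) - \<phi> (grid N e i) * edge_cos k (h e)) / edge_sin k (h e)" for e i
  define r where "r e i = (\<phi> (grid N e (Suc i)) * edge_cos k (h e) - \<phi> (grid N e i)) / edge_sin k (h e)" for e i
  have balance: "(\<Sum>(e', j) | (e', j) \<in> segments N \<and> grid N e' j = grid N e i. - l e' j) +
      (\<Sum>(e', j) | (e', j) \<in> segments N \<and> grid N e' (Suc j) = grid N e i. r e' j) = 0"
    if e: "e \<in> arcs G" and i: "i \<le> N" for e i
  proof -
    have 1: "(\<Sum>(e', j) | (e', j) \<in> segments N \<and> grid N e' j = grid N e i.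
        stiffness (len e' / real N) k * (\<phi> (grid N e' j) - \<phi> (grid N e' (Suc j)))
          - k\<^sup>2 * inertia (len e' / real N) k * \<phi> (grid N e' j)) =
       (\<Sum>(e', j) | (e', j) \<in> segments N \<and> grid N e' j = grid N e i. - l e' j)"
    proof (rule sum.cong[OF refl], clarify)
      fix e' j assume "(e', j) \<in> segments N"
      then have e': "e' \<in> arcs G" by (simp add: segments_def)
      show "stiffness (len e' / real N) k * (\<phi> (grid N e' j) - \<phi> (grid N e' (Suc j)))
          - k\<^sup>2 * inertia (len e' / real N) k * \<phi> (grid N e' j) = - l e' j"
        unfolding h_def[symmetric] l_def by (rule stiffness_inertia_slope[OF k h[OF e']])
    qed
    have 2: "(\<Sum>(e', j) | (e', j) \<in> segments N \<and> grid N e' (Suc j) = grid N e i.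
        stiffness (len e' / real N) k * (\<phi> (grid N e' (Suc j)) - \<phi> (grid N e' j))
          - k\<^sup>2 * inertia (len e' / real N) k * \<phi> (grid N e' (Suc j))) =
       (\<Sum>(e', j) | (e', j) \<in> segments N \<and> grid N e' (Suc j) = grid N e i. r e' j)"
    proof (rule sum.cong[OF refl], clarify)
      fix e' j assume "(e', j) \<in> segments N"
      then have e': "e' \<in> arcs G" by (simp add: segments_def)
      have "stiffness (len e' / real N) k * (\<phi> (grid N e' (Suc j)) - \<phi> (grid N e' j))
          - k\<^sup>2 * inertia (len e' / real N) k * \<phi> (grid N e' (Suc j)) =
          - ((\<phi> (grid N e' j) - \<phi> (grid N e' (Suc j)) * edge_cos k (h e')) / edge_sin k (h e'))"
        unfolding h_def[symmetric] by (rule stiffness_inertia_slope[OF k h[OF e']])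
      also have "\<dots> = r e' j"
        unfolding r_def minus_divide_left by (simp only: minus_diff_eq)
      finally show "stiffness (len e' / real N) k * (\<phi> (grid N e' (Suc j)) - \<phi> (grid N e' j))
          - k\<^sup>2 * inertia (len e' / real N) k * \<phi> (grid N e' (Suc j)) = r e' j" .
    qed
    show ?thesis using net[OF e i] unfolding 1 2 .
  qed
  have smooth: "r e i = l e (Suc i)" if e: "e \<in> arcs G" and i: "Suc i < N" for e i
  proof -
    have "{(e', j). (e', j) \<in> segments N \<and> grid N e' j = grid N e (Suc i)} = {(e, Suc i)}"
      using grid_eq_interior_iff[OF e zero_less_Suc i] e i by (auto simp: segments_def)
    moreover have "{(e', j). (e', j) \<in> segments N \<and> grid N e' (Suc j) = grid N e (Suc i)} = {(e, i)}"
      using grid_eq_interior_iff[OF e zero_less_Suc i] e i by (auto simp: segments_def)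
    ultimately show ?thesis using balance[OF e less_imp_le[OF i]] by simp
  qed
  define F where "F e x = \<phi> (grid N e 0) * edge_cos k x + l e 0 * edge_sin k x" for e x
  define F' where "F' e x = - k\<^sup>2 * (\<phi> (grid N e 0) * edge_sin k x) + l e 0 * edge_cos k x" for e x
  have F_step: "F e (x + y) = F e x * edge_cos k y + F' e x * edge_sin k y"
    and F'_step: "F' e (x + y) = F' e x * edge_cos k y - k\<^sup>2 * F e x * edge_sin k y" for e x y
    unfolding F_def F'_def edge_trig_add by (simp_all add: algebra_simps power2_eq_square)
  have sin_pos: "0 < edge_sin k (h e)" if "e \<in> arcs G" for e
    unfolding edge_sin_def using k h[OF that] by (simp add: sin_gt_zero)
  have next_val: "F e (real (Suc i) * h e) = \<phi> (grid N e (Suc i))" "F' e (real (Suc i) * h e) = r e i"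
    if e: "e \<in> arcs G" and val: "F e (real i * h e) = \<phi> (grid N e i)" "F' e (real i * h e) = l e i" for e i
  proof -
    have eq: "real (Suc i) * h e = real i * h e + h e" by (simp add: algebra_simps)
    note s = sin_pos[OF e]
    show "F e (real (Suc i) * h e) = \<phi> (grid N e (Suc i))"
      unfolding eq F_step val l_def using s by simp
    have id: "k\<^sup>2 * (edge_sin k (h e))\<^sup>2 = 1 - (edge_cos k (h e))\<^sup>2"
      using edge_cos_sin_identity[of k "h e"] by linarith
    have "F' e (real (Suc i) * h e) * edge_sin k (h e) =
        (\<phi> (grid N e (Suc i)) - \<phi> (grid N e i) * edge_cos k (h e)) * edge_cos k (h e) -
        (k\<^sup>2 * (edge_sin k (h e))\<^sup>2) * \<phi> (grid N e i)"
      unfolding eq F'_step val l_def using s by (simp add: field_simps power2_eq_square)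
    also have "\<dots> = r e i * edge_sin k (h e)"
      unfolding id r_def using s by (simp add: field_simps power2_eq_square)
    finally show "F' e (real (Suc i) * h e) = r e i" using s by simp
  qed
  have val: "F e (real i * h e) = \<phi> (grid N e i) \<and> F' e (real i * h e) = l e i"
    if e: "e \<in> arcs G" and "i < N" for e i
    using \<open>i < N\<close>
  proof (induction i)
    case 0
    show ?case by (simp add: F_def F'_def)
  next
    case (Suc i)
    then show ?case using next_val[OF e, of i] smooth[OF e Suc.prems] by simp
  qed
  have val_end: "F e (len e) = \<phi> (Vertex (head G e))" "F' e (len e) = r e (N - 1)"
    if e: "e \<in> arcs G" for e
  proof -
    have v: "F e (real (N - 1) * h e) = \<phi> (grid N e (N - 1))" "F' e (real (N - 1) * h e) = l e (N - 1)"
      using val[OF e, of "N - 1"] N by auto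
    have "Suc (N - 1) = N" "real N * h e = len e" using N by (simp_all add: h_def)
    then show "F e (len e) = \<phi> (Vertex (head G e))" "F' e (len e) = r e (N - 1)"
      using next_val[OF e v] grid_ends(2)[OF e N] by simp_all
  qed
  have kirchhoff: "(\<Sum>e\<in>out_arcs G v. F' e 0) + (\<Sum>e\<in>in_arcs G v. - F' e (len e)) = 0"
    if v: "v \<in> verts G" for v
  proof -
    obtain e i where ei: "e \<in> arcs G" "i \<le> N" "grid N e i = Vertex v"
    proof -
      have "Vertex v \<in> points G len" using v by (simp add: points_def)
      then obtain e t where et: "e \<in> arcs G" "t \<in> {0..len e}" "Vertex v = edge_point G len e t"
        by (rule point_on_edge)
      then have "v = tail G e \<or> v = head G e"
        by (auto simp: edge_point_def split: if_splits)
      then show thesis using that[of e 0] that[of e N] grid_ends[OF et(1) N] et(1) by auto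
    qed
    have A: "{(e', j). (e', j) \<in> segments N \<and> grid N e' j = Vertex v} = (\<lambda>e. (e, 0)) ` out_arcs G v"
      using grid_eq_Vertex_iff(1) N by (auto simp: segments_def out_arcs_def)
    have B: "{(e', j). (e', j) \<in> segments N \<and> grid N e' (Suc j) = Vertex v} = (\<lambda>e. (e, N - 1)) ` in_arcs G v"
      using grid_eq_Vertex_iff(2) grid_ends(2)[OF _ N] N by (auto simp: segments_def in_arcs_def)
    have "(\<Sum>e\<in>out_arcs G v. - l e 0) + (\<Sum>e\<in>in_arcs G v. r e (N - 1)) = 0"
      using balance[OF ei(1,2)] unfolding ei(3) A B
      by (subst (asm) (1 2) sum.reindex) (auto simp: inj_on_def)
    moreover have "(\<Sum>e\<in>out_arcs G v. F' e 0) = (\<Sum>e\<in>out_arcs G v. l e 0)"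
      by (simp add: F'_def)
    moreover have "(\<Sum>e\<in>in_arcs G v. F' e (len e)) = (\<Sum>e\<in>in_arcs G v. r e (N - 1))"
      using val_end(2) by (intro sum.cong) auto
    ultimately show ?thesis by (simp add: sum_negf)
  qed
  have F_i0: "F e0 (real i0 * h e0) = \<phi> (grid N e0 i0)"
  proof (cases "i0 < N")
    case True
    then show ?thesis using val[OF nz(1)] by simp
  next
    case False
    then have "i0 = N" "real N * h e0 = len e0" using nz(2) N by (simp_all add: h_def)
    then show ?thesis using val_end(1)[OF nz(1)] grid_ends(2)[OF nz(1) N] by simp
  qed
  show ?thesis
  proof (rule eigenvalue_of_real_eigenfunction)
    fix e x
    show "(F e has_real_derivative F' e x) (at x)"
      unfolding F_def[abs_def] F'_def
      by (rule DERIV_cong[OF DERIV_add[OF DERIV_cmult[OF edge_cos_deriv] DERIV_cmult[OF edge_sin_deriv]]])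
        (simp add: algebra_simps)
    show "(F' e has_real_derivative - (k\<^sup>2) * F e x) (at x)"
      unfolding F_def F'_def[abs_def]
      by (rule DERIV_cong[OF DERIV_add[OF DERIV_cmult[OF DERIV_cmult[OF edge_sin_deriv]] DERIV_cmult[OF edge_cos_deriv]]])
        (simp add: algebra_simps)
  next
    fix e assume e: "e \<in> arcs G"
    show "F e 0 = \<phi> (Vertex (tail G e))" using grid_ends(1)[OF e N] by (simp add: F_def)
    show "F e (len e) = \<phi> (Vertex (head G e))" by (rule val_end(1)[OF e])
  next
    show "F e0 (real i0 * h e0) \<noteq> 0" using F_i0 nz(3) by simp
    show "real i0 * h e0 \<in> {0..len e0}" unfolding h_def by (rule grid_coordinate[OF nz(1) N nz(2)])
    show "e0 \<in> arcs G" by (rule nz(1))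
  qed (rule kirchhoff)
qed

end

section \<open>The distance function as test function\<close>

context connected_metric_graph
begin

text \<open>
  The numbers: \<open>N\<close> is large enough for \<open>h \<le> D/40\<close> and \<open>Kh \<le> 1/2\<close> on all segments. Starting
  from points at distance \<open>19D/20\<close>, moving both to the grid leaves an oscillation of at least
  \<open>9D/10\<close>. The form at \<open>K\<close> is then at most \<open>6L/5 - K\<^sup>2(9D/10)\<^sup>3/12\<close>, which is negative for
  \<open>K\<^sup>2 = 20L/D\<^sup>3\<close> since \<open>20 \<cdot> 0.729 / 12 = 1.215\<close>.
\<close>

lemma second_eigenvalue_bound:
  fixes D L :: real
  defines "D \<equiv> mg_diameter G len" and "L \<equiv> total_length G len"
  shows "kth_eigenvalue G len 2 \<le> 20 * L / D ^ 3"
proof -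
  have D: "0 < D" unfolding D_def by (rule mg_diameter_pos)
  have L: "0 < L" unfolding L_def by (rule total_length_pos)
  define K where "K = sqrt (20 * L / D ^ 3)"
  have K: "0 < K" "K\<^sup>2 = 20 * L / D ^ 3"
    using D L by (simp_all add: K_def)
  define N where "N = nat \<lceil>max (2 * K * L) (40 * L / D)\<rceil> + 1"
  have N: "0 < N" by (simp add: N_def)
  have "max (2 * K * L) (40 * L / D) \<le> real N" unfolding N_def by linarith
  then have N1: "2 * K * L \<le> real N" and N2: "40 * L / D \<le> real N" by auto
  have KL: "K * (L / real N) \<le> 1 / 2" using N1 N by (simp add: field_simps)
  have DL: "L / real N \<le> D / 40" using N2 N D by (simp add: field_simps)
  have h: "0 < len e / real N" "len e / real N \<le> L / real N" if "e \<in> arcs G" for e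
    using len_pos[OF that] len_le_total[OF that] N unfolding L_def by (auto intro: divide_right_mono)
  have Kh: "k * (len e / real N) \<le> 1 / 2" if "e \<in> arcs G" "k \<le> K" "0 \<le> k" for e k
  proof -
    have "k * (len e / real N) \<le> K * (L / real N)"
      using h[OF that(1)] that K by (intro mult_mono) auto
    with KL show ?thesis by linarith
  qed

  let ?a = "\<lambda>(e, i). grid N e i" and ?b = "\<lambda>(e, i). grid N e (Suc i)"
  let ?\<sigma> = "\<lambda>(e, i). stiffness (len e / real N)" and ?\<tau> = "\<lambda>(e, i). inertia (len e / real N)"
  interpret base: finite_network "segments N" ?a ?b
    by (rule network_of_grid[OF N])
  interpret net: weighted_network "segments N" ?a ?b ?\<sigma> ?\<tau> K
  proof
    show "0 < K" by (rule K(1))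
    fix s assume "s \<in> segments N"
    then obtain e i where s: "s = (e, i)" and e: "e \<in> arcs G" by (auto simp: segments_def)
    note he = h(1)[OF e]
    show "continuous_on {0..K} (?\<sigma> s)" "continuous_on {0..K} (?\<tau> s)"
      unfolding s prod.case using weight_continuous[OF he Kh[OF e]] K by auto
    fix k assume k: "k \<in> {0..K}"
    then have kh: "0 \<le> k" "k * (len e / real N) \<le> 1 / 2" using Kh[OF e] by auto
    show "0 < ?\<sigma> s k" "0 < ?\<tau> s k"
      unfolding s prod.case
      using weight_bounds(1)[OF he kh] less_le_trans[OF half_gt_zero[OF he] weight_bounds(3)[OF he kh]] .
  qed

  have "19 / 20 * D < mg_diameter G len" using D unfolding D_def by simp
  then obtain p q where pq: "p \<in> points G len" "q \<in> points G len" "19 / 20 * D < mg_dist G len p q"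
    by (rule nearly_diametral_points)
  define d where "d = mg_dist G len p"
  obtain e1 i1 where n1: "e1 \<in> arcs G" "i1 \<le> N" "\<bar>d (grid N e1 i1) - d p\<bar> \<le> L / real N"
    unfolding d_def L_def using near_grid_point[OF N pq(1) pq(1)] .
  obtain e2 i2 where n2: "e2 \<in> arcs G" "i2 \<le> N" "\<bar>d (grid N e2 i2) - d q\<bar> \<le> L / real N"
    unfolding d_def L_def using near_grid_point[OF N pq(1) pq(2)] .
  define x1 x2 where "x1 = grid N e1 i1" and "x2 = grid N e2 i2"
  have nodes_eq: "base.nodes = {grid N e i | e i. e \<in> arcs G \<and> i \<le> N}"
    unfolding base.nodes_def by (rule grid_points[OF N])
  have X12: "x1 \<in> base.nodes" "x2 \<in> base.nodes"
    unfolding nodes_eq x1_def x2_def using n1 n2 by blast+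
  have dx: "9 / 10 * D \<le> d x2 - d x1"
    using n1(3) n2(3) pq(3) DL mg_dist_self[of p] unfolding d_def x1_def x2_def by linarith

  \<comment> \<open>The test function: the distance from \<open>p\<close> at the nodes, shifted so that its extension has mean zero.\<close>
  define \<psi> where "\<psi> = net.recentred K d"
  have \<psi>_diff: "\<psi> x - \<psi> y = d x - d y" for x y
    by (simp add: \<psi>_def net.recentred_def)
  have mass0: "net.mass K \<psi> = 0"
    unfolding \<psi>_def by (rule net.mass_recentred) (use K in auto)
  define hs where "hs s = len (fst s) / real N" for s :: "'b \<times> nat"
  have bound: "net.form K \<psi> \<psi> \<le> (\<Sum>s\<in>segments N. 6 / 5 * hs s
      - K\<^sup>2 * (hs s / 2 * ((\<psi> (?a s))\<^sup>2 + (\<psi> (?b s))\<^sup>2)))"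
    unfolding net.form_def
  proof (rule sum_mono)
    fix s assume "s \<in> segments N"
    then obtain e i where s: "s = (e, i)" and e: "e \<in> arcs G" and i: "i < N" by (auto simp: segments_def)
    have hs: "hs s = len e / real N" "0 < hs s" using h(1)[OF e] by (simp_all add: hs_def s)
    have Khs: "K * hs s \<le> 1 / 2" using Kh[OF e order.refl] K hs(1) by simp
    note w = weight_bounds[OF hs(2) less_imp_le[OF K(1)] Khs]
    have step: "\<bar>\<psi> (?a s) - \<psi> (?b s)\<bar> \<le> hs s"
      unfolding \<psi>_diff s d_def prod.case hs_def fst_conv by (rule grid_step_lipschitz[OF pq(1) e i])
    have "(\<psi> (?a s) - \<psi> (?b s))\<^sup>2 \<le> (hs s)\<^sup>2"
      using power_mono[OF step abs_ge_zero, of 2] by simp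
    then have "stiffness (hs s) K * (\<psi> (?a s) - \<psi> (?b s))\<^sup>2 \<le> 6 / 5 / hs s * (hs s)\<^sup>2"
      using w(1,2) hs(2) by (intro mult_mono) auto
    also have "\<dots> = 6 / 5 * hs s" using hs(2) by (simp add: power2_eq_square)
    finally have 1: "stiffness (hs s) K * (\<psi> (?a s) - \<psi> (?b s))\<^sup>2 \<le> 6 / 5 * hs s" .
    have "K\<^sup>2 * (hs s / 2 * ((\<psi> (?a s))\<^sup>2 + (\<psi> (?b s))\<^sup>2)) \<le>
        K\<^sup>2 * (inertia (hs s) K * ((\<psi> (?a s))\<^sup>2 + (\<psi> (?b s))\<^sup>2))"
      using w(3) by (intro mult_left_mono mult_right_mono) auto
    moreover have "?\<sigma> s K * (\<psi> (?a s) - \<psi> (?b s)) * (\<psi> (?a s) - \<psi> (?b s))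
        - K\<^sup>2 * ?\<tau> s K * (\<psi> (?a s) * \<psi> (?a s) + \<psi> (?b s) * \<psi> (?b s)) =
        stiffness (hs s) K * (\<psi> (?a s) - \<psi> (?b s))\<^sup>2
        - K\<^sup>2 * (inertia (hs s) K * ((\<psi> (?a s))\<^sup>2 + (\<psi> (?b s))\<^sup>2))"
      unfolding s hs_def prod.case fst_conv power2_eq_square by (simp only: mult.assoc)
    ultimately show "?\<sigma> s K * (\<psi> (?a s) - \<psi> (?b s)) * (\<psi> (?a s) - \<psi> (?b s))
      - K\<^sup>2 * ?\<tau> s K * (\<psi> (?a s) * \<psi> (?a s) + \<psi> (?b s) * \<psi> (?b s))
      \<le> 6 / 5 * hs s - K\<^sup>2 * (hs s / 2 * ((\<psi> (?a s))\<^sup>2 + (\<psi> (?b s))\<^sup>2))"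
      using 1 by linarith
  qed
  have sum_hs: "(\<Sum>s\<in>segments N. hs s) = L"
    unfolding L_def sum_segments[OF N, symmetric] hs_def by (simp add: case_prod_beta)
  have "(9 / 10 * D) ^ 3 / 12 \<le> (d x2 - d x1) ^ 3 / 12"
    using dx D by (intro divide_right_mono power_mono) auto
  also have "\<dots> = (\<psi> x2 - \<psi> x1) ^ 3 / 12" by (simp only: \<psi>_diff)
  also have "\<dots> \<le> (\<psi> x2) ^ 3 / 3 - (\<psi> x1) ^ 3 / 3"
    by (rule cube_difference_bounds(2)) (use dx D \<psi>_diff[of x2 x1] in linarith)
  also have "\<dots> \<le> (\<Sum>s\<in>segments N. \<bar>(\<psi> (?a s)) ^ 3 / 3 - (\<psi> (?b s)) ^ 3 / 3\<bar>)"
    by (rule base.range_le_total_variation[OF X12])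
  also have "\<dots> \<le> (\<Sum>s\<in>segments N. hs s / 2 * ((\<psi> (?a s))\<^sup>2 + (\<psi> (?b s))\<^sup>2))"
  proof (rule sum_mono, rule cube_difference_bounds(1))
    fix s assume "s \<in> segments N"
    then obtain e i where s: "s = (e, i)" and e: "e \<in> arcs G" and i: "i < N" by (auto simp: segments_def)
    show "\<bar>\<psi> (?a s) - \<psi> (?b s)\<bar> \<le> hs s"
      unfolding \<psi>_diff s d_def prod.case hs_def fst_conv by (rule grid_step_lipschitz[OF pq(1) e i])
  qed
  finally have var: "(9 / 10 * D) ^ 3 / 12 \<le> (\<Sum>s\<in>segments N. hs s / 2 * ((\<psi> (?a s))\<^sup>2 + (\<psi> (?b s))\<^sup>2))" .
  have "net.form K \<psi> \<psi> \<le> 6 / 5 * L - K\<^sup>2 * (\<Sum>s\<in>segments N. hs s / 2 * ((\<psi> (?a s))\<^sup>2 + (\<psi> (?b s))\<^sup>2))"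
    using bound unfolding sum_subtractf sum_distrib_left[symmetric] sum_hs .
  also have "\<dots> \<le> 6 / 5 * L - K\<^sup>2 * ((9 / 10 * D) ^ 3 / 12)"
    using var by (intro diff_left_mono mult_left_mono) auto
  also have "\<dots> = 6 / 5 * L - 1215 / 1000 * L"
    unfolding K(2) using D by (simp add: power_mult_distrib field_simps)
  also have "\<dots> \<le> 0" using L by simp
  finally have form: "net.form K \<psi> \<psi> \<le> 0" .
  have "\<psi> x1 \<noteq> 0 \<or> \<psi> x2 \<noteq> 0" using \<psi>_diff[of x2 x1] dx D by auto
  then obtain x where x: "x \<in> base.nodes" "\<psi> x \<noteq> 0" using X12 by blast
  obtain k \<phi> y where k: "0 < k" "k \<le> K" and y: "y \<in> base.nodes" "\<phi> y \<noteq> 0"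
    and ker: "\<And>x. x \<in> base.nodes \<Longrightarrow> net.vertex_op k \<phi> x = 0"
    by (rule net.kernel_exists[OF mass0 form x]) blast
  obtain e0 i0 where y0: "e0 \<in> arcs G" "i0 \<le> N" "y = grid N e0 i0"
    using y(1) unfolding nodes_eq by blast
  have "k\<^sup>2 \<in> eigenvalues G len"
  proof (rule eigenvalue_of_grid_function[OF N k(1), where \<phi> = \<phi>])
    show "k * (len e / real N) < pi" if "e \<in> arcs G" for e
      using Kh[OF that k(2)] k(1) pi_gt3 by linarith
    show "\<phi> (grid N e0 i0) \<noteq> 0" using y(2) y0(3) by simp
    fix e i assume "e \<in> arcs G" "i \<le> N"
    then have "net.vertex_op k \<phi> (grid N e i) = 0" by (intro ker) (auto simp: nodes_eq)
    then show "(\<Sum>(e', j) | (e', j) \<in> segments N \<and> grid N e' j = grid N e i.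
        stiffness (len e' / real N) k * (\<phi> (grid N e' j) - \<phi> (grid N e' (Suc j)))
          - k\<^sup>2 * inertia (len e' / real N) k * \<phi> (grid N e' j)) +
      (\<Sum>(e', j) | (e', j) \<in> segments N \<and> grid N e' (Suc j) = grid N e i.
        stiffness (len e' / real N) k * (\<phi> (grid N e' (Suc j)) - \<phi> (grid N e' j))
          - k\<^sup>2 * inertia (len e' / real N) k * \<phi> (grid N e' (Suc j))) = 0"
      unfolding net.vertex_op_def by (simp only: case_prod_beta' prod.collapse)
  qed (rule y0(1,2))+
  then have "kth_eigenvalue G len 2 \<le> k\<^sup>2" by (rule second_eigenvalue_le[OF k(1)])
  also have "\<dots> \<le> K\<^sup>2" using k by (intro power_mono) auto
  finally show ?thesis unfolding K(2) .
qed

end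

theorem theorem1p9:
  fixes G :: "('v, 'e) pre_digraph" and len :: "'e \<Rightarrow> real" and D L :: real
  assumes "metric_graph G len"
    and "Digraph_Component.connected G"
    and "D = mg_diameter G len"
    and "L = total_length G len"
  shows "kth_eigenvalue G len 2 < 24 * L / D ^ 3"
proof -
  interpret metric_graph G len by fact
  interpret connected_metric_graph G len by unfold_locales fact
  have "kth_eigenvalue G len 2 \<le> 20 * L / D ^ 3"
    unfolding assms(3,4) by (rule second_eigenvalue_bound)
  also have "\<dots> < 24 * L / D ^ 3"
    using mg_diameter_pos total_length_pos unfolding assms(3,4) by (intro divide_strict_right_mono) auto
  finally show ?thesis .
qed

end
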